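(* Let $\alpha>1$, let $\nu$ be an angular measure, and let $h\in\mathcal{C}^1(\mathbb{R}_+^d)\cap\mathrm{Lip}_1(\mathbb{R}_+^d)$. Put $\gamma_t=e^t-1$ and let $\zeta\sim\mathcal F(\alpha)$ be a scalar Fréchet random variable. (1) For every $t\ge0$, $\mathbf{P}_t h$ also belongs to $\mathcal{C}^1(\mathbb{R}_+^d)\cap\mathrm{Lip}_1(\mathbb{R}_+^d)$, and for all $j\in\{1,\dots,d\}$, $t\ge0$ and $x\in\mathbb{R}_+^d$, $$|\partial_j\mathbf{P}_t h(x)|\le e^{-t/\alpha}\,\mathbb{P}\big(\zeta\le\gamma_t^{-1/\alpha}x^j\big).$$ In particular, $$\|\nabla\mathbf{P}_t h(x)\|_1\le e^{-t/\alpha}\|p_t(x)\|_1,\qquad p_t(x)=\big(\mathbb{P}(\zeta\le\gamma_t^{-1/\alpha}x^1),\dots,\mathbb{P}(\zeta\le\gamma_t^{-1/\alpha}x^d)\big),$$ and as a result $\mathbf{P}_t h$ is $d\,e^{-t/\alpha}$-Lipschitz. (2) Assume in addition that $h\in\mathrm{Lip}^{[2]}_1(\mathbb{R}_+^d)$. Then for all $j\in\{1,\dots,d\}$ and $t>0$, $\partial_j\mathbf{P}_t h$ is $C_{1,\alpha}(t)$-Lipschitz, where $$C_{1,\alpha}(t)=(d-1)e^{-t/\alpha}+\alpha\gamma_t^{-1/\alpha}.$$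
   Context: Fix $d\ge 1$, $\mathbb{R}_+=[0,\infty)$. Operations on vectors (powers, inequalities) are coordinate-wise; $x\oplus y$ is the coordinate-wise maximum; $\|x\|_1=\sum_j|x^j|$; Lipschitz constants on $\mathbb{R}_+^d$ are with respect to $\|\cdot\|_1$. Let $E_0=[0,\infty)^d\setminus\{0\}$, $[0,x]=\prod_j[0,x^j]$ and $[0,x]^c$ its complement in $E_0$. Fix a norm $\|\cdot\|$ on $\mathbb{R}^d$ such that $\mathbf{S}_+^{d-1}=\{x\in\mathbb{R}_+^d:\|x\|=1\}\subseteq[0,1]^d$. An angular measure is a finite Borel measure $\nu$ on $\mathbf{S}_+^{d-1}$ with $\int u^j\,\mathrm d\nu(u)=1$ for $j=1,\dots,d$. For $\alpha>0$ the exponent measure $\mu$ is the pushforward of $\alpha r^{-\alpha-1}\mathrm dr\otimes\nu(\mathrm du)$ on $(0,\infty)\times\mathbf{S}_+^{d-1}$ by $(r,u)\mapsto r\,u^{1/\alpha}$. $\mathcal{MS}(\alpha,\nu)$ is the law of the max-stable random vector $Z$ on $(0,\infty)^d$ with $\mathbb{P}(Z\le z)=e^{-\mu([0,z]^c)}$, $z\in(0,\infty)^d$. $\mathcal F(\alpha)$ is the Fréchet law with c.d.f. $e^{-x^{-\alpha}}$ for $x>0$ and $0$ for $x\le 0$. $\mathrm{Lip}_1(\mathbb{R}_+^d)$ is the set of $h:\mathbb{R}_+^d\to\mathbb{R}$ with $|h(x)-h(y)|\le\|x-y\|_1$; $\mathrm{Lip}^{[2]}_1(\mathbb{R}_+^d)$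 is the set of $h:\mathbb{R}_+^d\to\mathbb{R}$ such that $h$ and $\partial_jh$, for every $j$, are $1$-Lipschitz. The semi-group is $\mathbf{P}_t h(x)=\mathbb{E}\big[h\big(e^{-t/\alpha}x\oplus(1-e^{-t})^{1/\alpha}Z\big)\big]$ with $Z\sim\mathcal{MS}(\alpha,\nu)$. For $t=0$, $\mathbb{P}(\zeta\le\gamma_t^{-1/\alpha}x^j)$ is read as $\mathbb{P}(\gamma_t^{1/\alpha}\zeta\le x^j)=1$. *)

theory Defs
  imports "HOL-Probability.Probability"
begin

text \<open>
  Vectors are elements of \<open>real ^ 'd\<close>, so the dimension is \<open>CARD('d)\<close>. The order, the intervals and
  \<open>sup\<close> on this type are coordinate-wise. Functions on the orthant are represented by
  total functions on \<open>real ^ 'd\<close> of which only the values on the orthant are ever used.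
\<close>

definition orthant :: "(real ^ 'd) set" where
  "orthant = {x. 0 \<le> x}"

definition open_orthant :: "(real ^ 'd) set" where
  "open_orthant = {x. \<forall>j. 0 < x $ j}"

definition punctured_orthant :: "(real ^ 'd) set" where
  "punctured_orthant = orthant - {0}"

definition l1_norm :: "real ^ 'd \<Rightarrow> real" where
  "l1_norm x = (\<Sum>j\<in>UNIV. \<bar>x $ j\<bar>)"

definition vec_powr :: "real ^ 'd \<Rightarrow> real \<Rightarrow> real ^ 'd" where
  "vec_powr x a = (\<chi> j. (x $ j) powr a)"

definition is_norm :: "('a::real_vector \<Rightarrow> real) \<Rightarrow> bool" where
  "is_norm N \<longleftrightarrow>
     (\<forall>x. N x = 0 \<longleftrightarrow> x = 0) \<and>
     (\<forall>x y. N (x + y) \<le> N x + N y) \<and>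
     (\<forall>c x. N (c *\<^sub>R x) = \<bar>c\<bar> * N x)"

definition pos_sphere :: "(real ^ 'd \<Rightarrow> real) \<Rightarrow> (real ^ 'd) set" where
  "pos_sphere N = {x \<in> orthant. N x = 1}"

definition angular_measure :: "(real ^ 'd \<Rightarrow> real) \<Rightarrow> (real ^ 'd) measure \<Rightarrow> bool" where
  "angular_measure N \<nu> \<longleftrightarrow>
     finite_measure \<nu> \<and>
     sets \<nu> = sets (restrict_space borel (pos_sphere N)) \<and>
     (\<forall>j. (\<integral>u. u $ j \<partial>\<nu>) = 1)"

definition exponent_measure :: "real \<Rightarrow> (real ^ 'd) measure \<Rightarrow> (real ^ 'd) measure" where
  "exponent_measure \<alpha> \<nu> =
     distr
       (density (restrict_space lborel {0<..}) (\<lambda>r. ennreal (\<alpha> * r powr (- \<alpha> - 1))) \<Otimes>\<^sub>M \<nu>)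
       (restrict_space borel punctured_orthant)
       (\<lambda>(r, u). r *\<^sub>R vec_powr u (1 / \<alpha>))"

text \<open>
  The law on the open orthant is characterised by its distribution function. The real-valued
  \<open>measure\<close> in the exponent is harmless: the complement of \<open>{0..z}\<close> has finite mass, at most the
  sum of the numbers \<open>(z $ j) powr (- \<alpha>)\<close>, for every \<open>z\<close> in the open orthant.
\<close>

definition max_stable_law ::
    "real \<Rightarrow> (real ^ 'd) measure \<Rightarrow> (real ^ 'd) measure \<Rightarrow> bool" where
  "max_stable_law \<alpha> \<nu> D \<longleftrightarrow>
     prob_space D \<and>
     sets D = sets (restrict_space borel open_orthant) \<and>
     (\<forall>z\<in>open_orthant.
        measure D {y \<in> open_orthant. y \<le> z} =
        exp (- measure (exponent_measure \<alpha> \<nu>) (punctured_orthant - {0..z})))"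

definition frechet_law :: "real \<Rightarrow> real measure \<Rightarrow> bool" where
  "frechet_law \<alpha> F \<longleftrightarrow>
     real_distribution F \<and>
     (\<forall>x. cdf F x = (if x \<le> 0 then 0 else exp (- (x powr (- \<alpha>)))))"

definition lipschitz_l1 :: "real \<Rightarrow> (real ^ 'd \<Rightarrow> real) \<Rightarrow> bool" where
  "lipschitz_l1 C h \<longleftrightarrow> (\<forall>x\<in>orthant. \<forall>y\<in>orthant. \<bar>h x - h y\<bar> \<le> C * l1_norm (x - y))"

definition Lip1 :: "(real ^ 'd \<Rightarrow> real) set" where
  "Lip1 = {h. lipschitz_l1 1 h}"

text \<open>
  Partial derivatives at a point of the orthant are derivatives within \<open>{0..}\<close> of the
  one-variable section, hence right derivatives where the coordinate vanishes.
\<close>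

definition coord_section :: "'d \<Rightarrow> (real ^ 'd \<Rightarrow> real) \<Rightarrow> real ^ 'd \<Rightarrow> real \<Rightarrow> real" where
  "coord_section j h x s = h (\<chi> i. if i = j then s else x $ i)"

definition partial_deriv :: "'d \<Rightarrow> (real ^ 'd \<Rightarrow> real) \<Rightarrow> real ^ 'd \<Rightarrow> real" where
  "partial_deriv j h x = vector_derivative (coord_section j h x) (at (x $ j) within {0..})"

definition has_partials :: "(real ^ 'd \<Rightarrow> real) \<Rightarrow> bool" where
  "has_partials h \<longleftrightarrow>
     (\<forall>j. \<forall>x\<in>orthant. coord_section j h x differentiable (at (x $ j) within {0..}))"

definition gradient :: "(real ^ 'd \<Rightarrow> real) \<Rightarrow> real ^ 'd \<Rightarrow> real ^ 'd" where
  "gradient h x = (\<chi> j. partial_deriv j h x)"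

definition C1_orthant :: "(real ^ 'd \<Rightarrow> real) set" where
  "C1_orthant = {h. has_partials h \<and> (\<forall>j. continuous_on orthant (partial_deriv j h))}"

definition Lip1_2 :: "(real ^ 'd \<Rightarrow> real) set" where
  "Lip1_2 = {h. lipschitz_l1 1 h \<and> has_partials h \<and> (\<forall>j. lipschitz_l1 1 (partial_deriv j h))}"

text \<open>The semi-group; \<open>D\<close> is the law of the random vector in its definition.\<close>

definition semigroup_P ::
    "real \<Rightarrow> (real ^ 'd) measure \<Rightarrow> real \<Rightarrow> (real ^ 'd \<Rightarrow> real) \<Rightarrow> real ^ 'd \<Rightarrow> real" where
  "semigroup_P \<alpha> D t h x =
     (\<integral>z. h (sup (exp (- t / \<alpha>) *\<^sub>R x) ((1 - exp (- t)) powr (1 / \<alpha>) *\<^sub>R z)) \<partial>D)"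

definition gamma_t :: "real \<Rightarrow> real" where
  "gamma_t t = exp t - 1"

text \<open>
  Here \<open>F\<close> is the law of the scalar Frechet variable. At \<open>t = 0\<close> the factor
  \<open>gamma_t t powr (- 1 / \<alpha>)\<close> would be \<open>0 powr _ = 0\<close> instead of infinity; the rescaled event has
  probability \<open>1\<close> there for \<open>x\<close> in the orthant.
\<close>

definition p_vec :: "real \<Rightarrow> real measure \<Rightarrow> real \<Rightarrow> real ^ 'd \<Rightarrow> real ^ 'd" where
  "p_vec \<alpha> F t x = (\<chi> j.
     if t = 0 then measure F {\<zeta>. gamma_t t powr (1 / \<alpha>) * \<zeta> \<le> x $ j}
     else measure F {\<zeta>. \<zeta> \<le> gamma_t t powr (- 1 / \<alpha>) * x $ j})"

end

theory Submission
  imports Defs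
begin

text \<open>
  Write \<open>a = exp (- t / \<alpha>)\<close>, \<open>b = (1 - exp (- t)) powr (1 / \<alpha>)\<close> and \<open>g\<close> for the \<open>j\<close>-th partial
  derivative of \<open>h\<close>, so that \<open>a / b = gamma_t t powr (- 1 / \<alpha>)\<close>. Of the max-stable law only its
  margins matter: each is Frechet, hence atomless, and integrable because \<open>\<alpha> > 1\<close>. As ties
  \<open>b * Z j = a * x j\<close> have probability zero, dominated convergence gives
  \<open>E[a * g (a x \<squnion> b Z); b * Z j \<le> a * x j]\<close> for the \<open>j\<close>-th partial derivative at \<open>x\<close>, which yields
  the first part. For the second part let \<open>x j \<le> y j\<close> and let \<open>F\<close> be the Frechet distribution
  function. The two derivatives differ by at most \<open>a\<^sup>2 * \<parallel>x - y\<parallel> * F (a / b * x j)\<close>, where both events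
  occur, plus \<open>a\<close> times the increment of \<open>F\<close>. The \<open>j\<close>-th coordinate is thus controlled by
  \<open>F + F' \<le> \<alpha>\<close>, and each of the other \<open>d - 1\<close> coordinates by \<open>a\<^sup>2 \<le> a\<close>.
\<close>

subsection \<open>Margins of the max-stable law\<close>

text \<open>The primitive \<open>- (r powr (- \<alpha>))\<close> tends to 0 at infinity, so only its
  value at \<open>a\<close> remains.\<close>

lemma nn_integral_pareto_tail:
  fixes \<alpha> a :: real
  assumes "\<alpha> > 0" "a > 0"
  shows "(\<integral>\<^sup>+r. indicator {a<..} r
      \<partial>density (restrict_space lborel {0<..}) (\<lambda>r. ennreal (\<alpha> * r powr (- \<alpha> - 1))))
    = ennreal (a powr (- \<alpha>))"
proof -
  have "(\<integral>\<^sup>+r. indicator {a<..} r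
      \<partial>density (restrict_space lborel {0<..}) (\<lambda>r. ennreal (\<alpha> * r powr (- \<alpha> - 1))))
    = (\<integral>\<^sup>+r. ennreal (\<alpha> * r powr (- \<alpha> - 1)) * indicator {a<..} r \<partial>restrict_space lborel {0<..})"
    by (subst nn_integral_density) (auto intro!: measurable_restrict_space1)
  also have "\<dots> = (\<integral>\<^sup>+r. ennreal (\<alpha> * r powr (- \<alpha> - 1)) * indicator {a<..} r * indicator {0<..} r \<partial>lborel)"
    by (subst nn_integral_restrict_space) auto
  \<comment> \<open>The endpoint \<open>a\<close> is a null set; closing the half-line there fits
    the form of the fundamental theorem of calculus applied next.\<close>
  also have "\<dots> = (\<integral>\<^sup>+r. ennreal (\<alpha> * r powr (- \<alpha> - 1)) * indicator {a..} r \<partial>lborel)"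
  proof (rule nn_integral_cong_AE)
    show "AE r in lborel. ennreal (\<alpha> * r powr (- \<alpha> - 1)) * indicator {a<..} r * indicator {0<..} r
        = ennreal (\<alpha> * r powr (- \<alpha> - 1)) * indicator {a..} r"
      using AE_lborel_singleton[of a] by eventually_elim (use assms in \<open>auto simp: indicator_def\<close>)
  qed
  also have "\<dots> = ennreal (0 - (- (a powr (- \<alpha>))))"
  proof (rule nn_integral_FTC_atLeast)
    show "((\<lambda>r. - (r powr - \<alpha>)) \<longlongrightarrow> 0) at_top"
      using tendsto_minus[OF tendsto_neg_powr[of "-\<alpha>" "\<lambda>x. x" at_top]] assms
      by (simp add: filterlim_ident)
  qed (use assms in \<open>auto intro!: derivative_eq_intros\<close>)
  finally show ?thesis by simp
qed

text \<open>A vector with \<open>N u = 1\<close> has a nonzero coordinate, which stays nonzero under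
  the power and the scaling by \<open>r > 0\<close>, so the image avoids the origin. Measurability
  itself is checked coordinate by coordinate.\<close>

lemma measurable_polar_map:
  fixes N :: "real ^ 'd \<Rightarrow> real"
  assumes "is_norm N" and sets: "sets \<nu> = sets (restrict_space borel (pos_sphere N))"
  shows "(\<lambda>(r, u). r *\<^sub>R vec_powr u (1 / \<alpha>))
    \<in> density (restrict_space lborel {0<..}) f \<Otimes>\<^sub>M \<nu> \<rightarrow>\<^sub>M restrict_space borel punctured_orthant"
    (is "?f \<in> ?L \<Otimes>\<^sub>M \<nu> \<rightarrow>\<^sub>M _")
proof (rule measurable_restrict_space2)
  have sp: "space \<nu> = pos_sphere N"
    using sets_eq_imp_space_eq[OF sets] by (simp add: space_restrict_space)
  show "?f \<in> space (?L \<Otimes>\<^sub>M \<nu>) \<rightarrow> punctured_orthant"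
  proof (rule funcsetI, clarify)
    fix r :: real and u :: "real ^ 'd" assume "(r, u) \<in> space (?L \<Otimes>\<^sub>M \<nu>)"
    then have "0 < r" and u: "u \<in> pos_sphere N"
      by (auto simp: space_pair_measure space_restrict_space sp)
    have "N u = 1" using u by (simp add: pos_sphere_def)
    then have "u \<noteq> 0" using assms(1) unfolding is_norm_def by (metis zero_neq_one)
    then obtain j where "u $ j \<noteq> 0" by (auto simp: vec_eq_iff)
    then have "(r *\<^sub>R vec_powr u (1 / \<alpha>)) $ j \<noteq> 0" using \<open>0 < r\<close> by (simp add: vec_powr_def)
    then have "r *\<^sub>R vec_powr u (1 / \<alpha>) \<noteq> 0" by (metis zero_index)
    then show "r *\<^sub>R vec_powr u (1 / \<alpha>) \<in> punctured_orthant"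
      using \<open>0 < r\<close> by (simp add: punctured_orthant_def orthant_def vec_powr_def less_eq_vec_def)
  qed
  have id1: "fst \<in> borel_measurable (?L \<Otimes>\<^sub>M \<nu>)"
    by (rule measurable_compose[OF measurable_fst]) (auto intro!: measurable_restrict_space1)
  have id2: "snd \<in> borel_measurable (?L \<Otimes>\<^sub>M \<nu>)"
    by (rule measurable_compose[OF measurable_snd])
      (auto simp: measurable_cong_sets[OF sets refl] intro!: measurable_restrict_space1)
  have id3: "(\<lambda>x. snd x $ j) \<in> borel_measurable (?L \<Otimes>\<^sub>M \<nu>)" for j
    by (rule measurable_compose[OF id2]) (auto intro!: borel_measurable_continuous_onI continuous_intros)
  show "?f \<in> borel_measurable (?L \<Otimes>\<^sub>M \<nu>)"
  proof (subst borel_measurable_euclidean_space, safe)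
    fix i :: "real ^ 'd" assume "i \<in> Basis"
    then obtain j where j: "i = axis j 1" by (auto simp: Basis_vec_def)
    have "(\<lambda>x. fst x * (snd x $ j) powr (1 / \<alpha>)) \<in> borel_measurable (?L \<Otimes>\<^sub>M \<nu>)"
      using id1 id3 by measurable
    then show "(\<lambda>x. ?f x \<bullet> i) \<in> borel_measurable (?L \<Otimes>\<^sub>M \<nu>)"
      by (simp add: j inner_axis case_prod_unfold vec_powr_def)
  qed
qed

text \<open>In a fixed direction \<open>u\<close> the radii that carry coordinate \<open>j\<close>
  beyond \<open>s\<close> are those above \<open>s / (u $ j) powr (1 / \<alpha>)\<close>, a set of
  radial mass \<open>s powr (- \<alpha>) * u $ j\<close>. The normalisation of the angular measure
  then integrates \<open>u $ j\<close> to 1.\<close>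

lemma emeasure_exponent_measure_halfspace:
  fixes N :: "real ^ 'd \<Rightarrow> real"
  assumes "\<alpha> > 0" "is_norm N" "angular_measure N \<nu>" "s > 0"
  shows "emeasure (exponent_measure \<alpha> \<nu>) {y \<in> punctured_orthant. s < y $ j} = ennreal (s powr (- \<alpha>))"
proof -
  let ?L = "density (restrict_space lborel {0<..}) (\<lambda>r::real. ennreal (\<alpha> * r powr (- \<alpha> - 1)))"
  let ?f = "\<lambda>(r, u). r *\<^sub>R vec_powr u (1 / \<alpha>) :: real ^ 'd"
  let ?A = "{y \<in> punctured_orthant. s < y $ j}"
  have sets: "sets \<nu> = sets (restrict_space borel (pos_sphere N))"
    and int1: "(\<integral>u. u $ j \<partial>\<nu>) = 1" and "finite_measure \<nu>"
    using assms(3) by (auto simp: angular_measure_def)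
  interpret nu: finite_measure \<nu> by fact
  \<comment> \<open>The radial measure has infinite mass near 0, so slicing the product measure
    rests on sigma-finiteness, which holds because the density takes finite values.\<close>
  have "sigma_finite_measure (restrict_space lborel {0::real<..})"
    by (rule sigma_finite_measure_restrict_space) (auto simp: sigma_finite_lborel)
  then interpret L: sigma_finite_measure ?L
    by (subst sigma_finite_measure.sigma_finite_iff_density_finite)
      (auto intro!: measurable_restrict_space1)
  interpret pair_sigma_finite ?L \<nu> ..
  have sp: "space \<nu> = pos_sphere N"
    using sets_eq_imp_space_eq[OF sets] by (simp add: space_restrict_space)
  have meas: "?f \<in> ?L \<Otimes>\<^sub>M \<nu> \<rightarrow>\<^sub>M restrict_space borel punctured_orthant"
    by (rule measurable_polar_map[OF assms(2) sets])
  have A: "?A \<in> sets (restrict_space borel punctured_orthant)"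
  proof -
    have "{y::real^'d. s < y $ j} \<in> sets borel"
      by (intro borel_open open_Collect_less continuous_intros)
    moreover have "?A = punctured_orthant \<inter> {y. s < y $ j}" by auto
    ultimately show ?thesis by (auto simp: sets_restrict_space)
  qed
  have "emeasure (exponent_measure \<alpha> \<nu>) ?A = emeasure (?L \<Otimes>\<^sub>M \<nu>) (?f -` ?A \<inter> space (?L \<Otimes>\<^sub>M \<nu>))"
    unfolding exponent_measure_def by (rule emeasure_distr[OF meas A])
  also have "\<dots> = (\<integral>\<^sup>+u. emeasure ?L ((\<lambda>r. (r, u)) -` (?f -` ?A \<inter> space (?L \<Otimes>\<^sub>M \<nu>))) \<partial>\<nu>)"
    by (rule emeasure_pair_measure_alt2[OF measurable_sets[OF meas A]])
  also have "\<dots> = (\<integral>\<^sup>+u. ennreal (s powr (- \<alpha>) * u $ j) \<partial>\<nu>)"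
  proof (rule nn_integral_cong)
    fix u assume u: "u \<in> space \<nu>"
    let ?S = "(\<lambda>r. (r, u)) -` (?f -` ?A \<inter> space (?L \<Otimes>\<^sub>M \<nu>))"
    have "u $ j \<ge> 0"
      using u by (auto simp: sp pos_sphere_def orthant_def less_eq_vec_def)
    have S: "r \<in> ?S \<longleftrightarrow> 0 < r \<and> s < r * (u $ j) powr (1 / \<alpha>)" for r
      using measurable_space[OF meas, of "(r, u)"] u
      by (auto simp: space_pair_measure vec_powr_def space_restrict_space)
    show "emeasure ?L ?S = ennreal (s powr (- \<alpha>) * u $ j)"
    proof (cases "u $ j = 0")
      case True
      then have "?S = {}" using S assms(4) by auto
      then show ?thesis using True by simp
    next
      case False
      then have up: "u $ j > 0" using \<open>u $ j \<ge> 0\<close> by simp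
      define a where "a = s / (u $ j) powr (1 / \<alpha>)"
      have "a > 0" using up assms by (simp add: a_def)
      have Sa: "?S = {a<..}"
      proof (rule set_eqI)
        fix r
        have "s < r * (u $ j) powr (1 / \<alpha>) \<longleftrightarrow> a < r"
          using up by (simp add: a_def field_simps)
        then show "r \<in> ?S \<longleftrightarrow> r \<in> {a<..}" unfolding S using \<open>a > 0\<close> by auto
      qed
      have "{a<..} \<in> sets ?L" using \<open>a > 0\<close> by (auto simp: sets_restrict_space_iff)
      then have "emeasure ?L ?S = (\<integral>\<^sup>+r. indicator {a<..} r \<partial>?L)" unfolding Sa by simp
      also have "\<dots> = ennreal (a powr (- \<alpha>))"
        by (rule nn_integral_pareto_tail) (use assms \<open>a > 0\<close> in auto)
      also have "a powr (- \<alpha>) = s powr (- \<alpha>) * u $ j"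
        using up assms by (simp add: a_def powr_divide powr_powr powr_minus_divide)
      finally show ?thesis .
    qed
  qed
  also have "\<dots> = ennreal (\<integral>u. s powr (- \<alpha>) * u $ j \<partial>\<nu>)"
  proof (rule nn_integral_eq_integral)
    \<comment> \<open>The integral of a non-integrable function is 0 by convention, so the value 1
      forces integrability.\<close>
    have "integrable \<nu> (\<lambda>u. u $ j)" using int1 not_integrable_integral_eq by fastforce
    then show "integrable \<nu> (\<lambda>u. s powr (- \<alpha>) * u $ j)" by simp
    show "AE u in \<nu>. 0 \<le> s powr (- \<alpha>) * u $ j"
      by (rule AE_I2) (auto simp: sp pos_sphere_def orthant_def less_eq_vec_def)
  qed
  finally show ?thesis using int1 by simp
qed

text \<open>The complement of the box is the union over \<open>i\<close> of the half-spaces beyond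
  \<open>z $ i\<close>. A single half-space gives the lower bound and subadditivity the upper
  one.\<close>

lemma exponent_measure_bounds:
  fixes N :: "real ^ 'd \<Rightarrow> real"
  assumes "\<alpha> > 0" "is_norm N" "angular_measure N \<nu>" "z \<in> open_orthant"
  shows "(z $ j) powr (- \<alpha>) \<le> measure (exponent_measure \<alpha> \<nu>) (punctured_orthant - {0..z})"
    and "measure (exponent_measure \<alpha> \<nu>) (punctured_orthant - {0..z}) \<le> (\<Sum>i\<in>UNIV. (z $ i) powr (- \<alpha>))"
proof -
  let ?M = "exponent_measure \<alpha> \<nu>"
  let ?H = "\<lambda>i. {y \<in> punctured_orthant. z $ i < y $ i}"
  have eq: "punctured_orthant - {0..z} = (\<Union>i. ?H i)"
    by (force simp: punctured_orthant_def orthant_def less_eq_vec_def not_le dest: leD)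
  have pos: "z $ i > 0" for i using assms(4) by (simp add: open_orthant_def)
  have H: "emeasure ?M (?H i) = ennreal ((z $ i) powr (- \<alpha>))" for i
    by (rule emeasure_exponent_measure_halfspace[OF assms(1-3) pos])
  \<comment> \<open>A set outside the sigma-algebra has measure 0 by convention, so a nonzero value
    proves membership.\<close>
  have sets: "?H i \<in> sets ?M" for i
    using H[of i] pos[of i] by (intro emeasure_neq_0_sets) auto
  have "emeasure ?M (\<Union>i. ?H i) \<le> (\<Sum>i\<in>UNIV. emeasure ?M (?H i))"
    by (rule emeasure_subadditive_finite) (use sets in auto)
  also have "\<dots> = ennreal (\<Sum>i\<in>UNIV. (z $ i) powr (- \<alpha>))"
    by (simp add: H sum_ennreal)
  finally have le: "emeasure ?M (\<Union>i. ?H i) \<le> ennreal (\<Sum>i\<in>UNIV. (z $ i) powr (- \<alpha>))" .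
  show "measure ?M (punctured_orthant - {0..z}) \<le> (\<Sum>i\<in>UNIV. (z $ i) powr (- \<alpha>))"
    unfolding eq measure_def using enn2real_mono[OF le] by (simp add: sum_nonneg)
  have "emeasure ?M (?H j) \<le> emeasure ?M (\<Union>i. ?H i)"
    by (rule emeasure_mono) (use sets in auto)
  then have "ennreal ((z $ j) powr (- \<alpha>)) \<le> emeasure ?M (\<Union>i. ?H i)" by (simp add: H)
  \<comment> \<open>Finiteness matters because \<open>enn2real\<close> sends infinity to 0, which
    would break monotonicity.\<close>
  moreover have "emeasure ?M (\<Union>i. ?H i) < \<top>" using le_less_trans[OF le ennreal_less_top] .
  ultimately have "enn2real (ennreal ((z $ j) powr (- \<alpha>))) \<le> enn2real (emeasure ?M (\<Union>i. ?H i))"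
    by (rule enn2real_mono)
  then show "(z $ j) powr (- \<alpha>) \<le> measure ?M (punctured_orthant - {0..z})"
    unfolding eq measure_def by simp
qed

text \<open>All coordinates of the corner other than \<open>j\<close> are sent to infinity. The
  events increase to the marginal event, while the exponent is squeezed by
  \<open>exponent_measure_bounds\<close> between \<open>s powr (- \<alpha>)\<close> and the same
  number plus terms that vanish.\<close>

lemma max_stable_law_margin:
  fixes N :: "real ^ 'd \<Rightarrow> real"
  assumes "\<alpha> > 0" "is_norm N" "angular_measure N \<nu>" "max_stable_law \<alpha> \<nu> D" "s > 0"
  shows "measure D {y \<in> open_orthant. y $ j \<le> s} = exp (- (s powr (- \<alpha>)))"
proof -
  have "prob_space D" and sets: "sets D = sets (restrict_space borel open_orthant)"
    and law: "\<And>z. z \<in> open_orthant \<Longrightarrow> measure D {y \<in> open_orthant. y \<le> z} =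
        exp (- measure (exponent_measure \<alpha> \<nu>) (punctured_orthant - {0..z}))"
    using assms(4) by (auto simp: max_stable_law_def)
  interpret prob_space D by fact
  \<comment> \<open>\<open>Suc n\<close> rather than \<open>n\<close> keeps the corner in the open
    orthant at \<open>n = 0\<close>.\<close>
  define z where "z n = (\<chi> i. if i = j then s else real (Suc n))" for n
  have z: "z n \<in> open_orthant" for n using assms(5) by (simp add: z_def open_orthant_def)
  define A where "A n = {y \<in> open_orthant. y \<le> z n}" for n
  have "{y. y \<le> z n} \<in> sets borel" for n
    unfolding less_eq_vec_def using borel_closed[OF closed_interval_left_cart] by auto
  moreover have "A n = open_orthant \<inter> {y. y \<le> z n}" for n by (auto simp: A_def)
  ultimately have "range A \<subseteq> sets D" by (auto simp: sets sets_restrict_space)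
  moreover have "incseq A"
  proof (rule monoI)
    fix m n :: nat assume "m \<le> n"
    then have "z m \<le> z n" by (simp add: z_def less_eq_vec_def)
    then show "A m \<subseteq> A n" by (auto simp: A_def)
  qed
  ultimately have "(\<lambda>n. measure D (A n)) \<longlonglongrightarrow> measure D (\<Union>n. A n)"
    by (rule finite_Lim_measure_incseq)
  moreover have "(\<Union>n. A n) = {y \<in> open_orthant. y $ j \<le> s}"
  proof safe
    fix y :: "real ^ 'd" assume y: "y \<in> open_orthant" "y $ j \<le> s"
    \<comment> \<open>The sum dominates every coordinate, since all are positive; so one
      \<open>n\<close> serves them all.\<close>
    obtain n where n: "(\<Sum>i\<in>UNIV. y $ i) \<le> real n" using real_arch_simple by blast
    have "y $ i \<le> real (Suc n)" for i
    proof -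
      have "y $ i \<le> (\<Sum>i\<in>UNIV. y $ i)"
        by (rule member_le_sum) (use y in \<open>auto simp: open_orthant_def less_imp_le\<close>)
      then show ?thesis using n by simp
    qed
    then have "y \<in> A n" using y by (auto simp: A_def z_def less_eq_vec_def)
    then show "y \<in> (\<Union>n. A n)" by blast
  qed (auto simp: A_def z_def less_eq_vec_def split: if_splits)
  ultimately have lim: "(\<lambda>n. measure D (A n)) \<longlonglongrightarrow> measure D {y \<in> open_orthant. y $ j \<le> s}"
    by simp
  let ?m = "\<lambda>n. measure (exponent_measure \<alpha> \<nu>) (punctured_orthant - {0..z n})"
  have t: "(\<lambda>n. real (Suc n) powr (- \<alpha>)) \<longlonglongrightarrow> 0"
    by (rule LIMSEQ_Suc, rule tendsto_neg_powr) (use assms filterlim_real_sequentially in auto)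
  have "?m \<longlonglongrightarrow> s powr (- \<alpha>)"
  proof (rule tendsto_sandwich)
    show "\<forall>\<^sub>F n in sequentially. s powr (- \<alpha>) \<le> ?m n"
      using exponent_measure_bounds(1)[OF assms(1-3) z, where j = j] by (simp add: z_def)
    show "\<forall>\<^sub>F n in sequentially. ?m n \<le> (\<Sum>i\<in>UNIV. if i = j then s powr (- \<alpha>) else real (Suc n) powr (- \<alpha>))"
    proof (rule always_eventually, rule allI)
      fix n
      have "(\<Sum>i\<in>UNIV. (z n $ i) powr (- \<alpha>)) = (\<Sum>i\<in>UNIV. if i = j then s powr (- \<alpha>) else real (Suc n) powr (- \<alpha>))"
        by (rule sum.cong) (auto simp: z_def)
      then show "?m n \<le> \<dots>"
        using exponent_measure_bounds(2)[OF assms(1-3) z[of n]] by simp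
    qed
    have "(\<lambda>n. \<Sum>i\<in>UNIV. if i = j then s powr (- \<alpha>) else real (Suc n) powr (- \<alpha>))
        \<longlonglongrightarrow> (\<Sum>i\<in>UNIV. if i = j then s powr (- \<alpha>) else 0)"
      by (rule tendsto_sum) (use t in auto)
    then show "(\<lambda>n. \<Sum>i\<in>UNIV. if i = j then s powr (- \<alpha>) else real (Suc n) powr (- \<alpha>)) \<longlonglongrightarrow> s powr (- \<alpha>)"
      by simp
  qed auto
  then have "(\<lambda>n. exp (- ?m n)) \<longlonglongrightarrow> exp (- (s powr (- \<alpha>)))" by (intro tendsto_intros)
  then have "(\<lambda>n. measure D (A n)) \<longlonglongrightarrow> exp (- (s powr (- \<alpha>)))"
    by (simp only: A_def law[OF z])
  with lim show ?thesis by (rule LIMSEQ_unique)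
qed

subsection \<open>The Frechet distribution function\<close>

text \<open>The quadratic Taylor bound at \<open>w\<close> is too weak once \<open>w > 2\<close>.
  Squaring the bound at \<open>w / 2\<close> yields a quartic whose excess over
  \<open>1 + w\<^sup>2\<close> is visibly nonnegative.\<close>

lemma one_plus_square_le_exp:
  fixes w :: real
  assumes "w \<ge> 0"
  shows "1 + w\<^sup>2 \<le> exp w"
proof -
  have "1 + w / 2 + (w / 2)\<^sup>2 / 2 \<le> exp (w / 2)"
    by (rule exp_lower_Taylor_quadratic) (use assms in simp)
  then have "(1 + w / 2 + (w / 2)\<^sup>2 / 2)\<^sup>2 \<le> (exp (w / 2))\<^sup>2"
    by (rule power_mono) (use assms in simp)
  also have "(exp (w / 2))\<^sup>2 = exp w"
    by (simp add: power2_eq_square flip: exp_add)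
  finally have "(1 + w / 2 + (w / 2)\<^sup>2 / 2)\<^sup>2 \<le> exp w" .
  moreover have "(1 + w / 2 + (w / 2)\<^sup>2 / 2)\<^sup>2 - (1 + w\<^sup>2)
      = w * ((w - 2)\<^sup>2 / 8 + 1 / 2) + w ^ 4 / 64"
    by (simp add: power2_eq_square power4_eq_xxxx field_simps)
  moreover have "w * ((w - 2)\<^sup>2 / 8 + 1 / 2) + w ^ 4 / 64 \<ge> 0"
    using assms by (intro add_nonneg_nonneg mult_nonneg_nonneg) auto
  ultimately show ?thesis by linarith
qed

text \<open>The case \<open>s \<le> 0\<close> is explicit because at 0 the formula would give 1, as
  \<open>0 powr _ = 0\<close>.\<close>

definition frechet_cdf :: "real \<Rightarrow> real \<Rightarrow> real" where
  "frechet_cdf \<alpha> s = (if s \<le> 0 then 0 else exp (- (s powr (- \<alpha>))))"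

lemma frechet_cdf_nonneg: "0 \<le> frechet_cdf \<alpha> s"
  by (simp add: frechet_cdf_def)

lemma frechet_cdf_le_1: "frechet_cdf \<alpha> s \<le> 1"
  by (simp add: frechet_cdf_def)

text \<open>The left side is the distribution function plus its density. With
  \<open>w = s powr (- \<alpha>)\<close> the claim reduces to
  \<open>1 + s powr (- \<alpha> - 1) \<le> exp w\<close>: for \<open>s \<ge> 1\<close> the power is
  at most \<open>w\<close>, and for \<open>s < 1\<close> it is at most
  \<open>w\<^sup>2\<close>.\<close>

lemma frechet_cdf_plus_density_le:
  fixes \<alpha> s :: real
  assumes "\<alpha> \<ge> 1" "s > 0"
  shows "exp (- (s powr (- \<alpha>))) * (1 + \<alpha> * s powr (- \<alpha> - 1)) \<le> \<alpha>"
proof -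
  define w where "w = s powr (- \<alpha>)"
  have "w \<ge> 0" by (simp add: w_def)
  have "1 + s powr (- \<alpha> - 1) \<le> exp w"
  proof (cases "s \<ge> 1")
    case True
    then have "s powr (- \<alpha> - 1) \<le> w" unfolding w_def by (intro powr_mono) auto
    then show ?thesis using exp_ge_add_one_self[of w] by linarith
  next
    case False
    then have "s powr (- \<alpha> - 1) \<le> s powr (- \<alpha> - \<alpha>)"
      using assms by (intro powr_mono') auto
    also have "\<dots> = w\<^sup>2" by (simp add: w_def power2_eq_square flip: powr_add)
    finally show ?thesis using one_plus_square_le_exp[OF \<open>w \<ge> 0\<close>] by linarith
  qed
  then have "\<alpha> * (1 + s powr (- \<alpha> - 1)) \<le> \<alpha> * exp w"
    using assms by (intro mult_left_mono) auto
  then have "1 + \<alpha> * s powr (- \<alpha> - 1) \<le> \<alpha> * exp w"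
    using assms by (simp add: algebra_simps)
  then show ?thesis
    by (simp add: exp_minus field_simps flip: w_def)
qed

text \<open>The mean value theorem turns the increment into the density at some \<open>r\<close>
  between \<open>s\<close> and \<open>t\<close>, and the value at \<open>s\<close> is at most the
  value at \<open>r\<close>, so the preceding bound applies at \<open>r\<close>. At
  \<open>s = 0\<close>, where the function is defined by cases, the estimate is made
  directly.\<close>

lemma frechet_cdf_increment:
  assumes "\<alpha> \<ge> 1" "0 \<le> s" "s \<le> t"
  shows "frechet_cdf \<alpha> t - frechet_cdf \<alpha> s + (t - s) * frechet_cdf \<alpha> s \<le> \<alpha> * (t - s)"
proof -
  consider "s = t" | "s = 0" "0 < t" | "0 < s" "s < t" using assms by linarith
  then show ?thesis
  proof cases
    case 2
    have "exp (- (t powr (- \<alpha>))) \<le> t"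
    proof (cases "t \<ge> 1")
      case True
      then show ?thesis by (intro order_trans[OF _ True]) simp
    next
      case False
      have "t powr (- 1) \<le> t powr (- \<alpha>)"
        using 2 assms False by (intro powr_mono') auto
      also have "\<dots> \<le> exp (t powr (- \<alpha>))"
        using exp_ge_add_one_self[of "t powr (- \<alpha>)"] by linarith
      finally have "1 / t \<le> exp (t powr (- \<alpha>))"
        using 2 by (simp add: powr_minus_divide)
      then show ?thesis using 2 by (simp add: exp_minus field_simps)
    qed
    also have "t \<le> \<alpha> * t" using assms 2 by simp
    finally show ?thesis using 2 by (simp add: frechet_cdf_def)
  next
    case 3
    let ?F = "\<lambda>r. exp (- (r powr (- \<alpha>)))" and ?f = "\<lambda>r. exp (- (r powr (- \<alpha>))) * (\<alpha> * r powr (- \<alpha> - 1))"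
    have "\<exists>r. s < r \<and> r < t \<and> ?F t - ?F s = (t - s) * ?f r"
      by (rule MVT2[OF 3(2)]) (use 3 in \<open>auto intro!: derivative_eq_intros\<close>)
    then obtain r where r: "s < r" "r < t" "?F t - ?F s = (t - s) * ?f r" by blast
    have "?F s \<le> ?F r" using r 3 assms by (simp add: powr_mono2')
    moreover have "?F r + ?f r \<le> \<alpha>"
      using frechet_cdf_plus_density_le[of \<alpha> r] r 3 assms by (simp add: algebra_simps)
    ultimately have "?F s + ?f r \<le> \<alpha>" by linarith
    then have "(t - s) * (?F s + ?f r) \<le> (t - s) * \<alpha>"
      using 3 by (intro mult_left_mono) auto
    then show ?thesis using r(3) 3 by (simp add: frechet_cdf_def algebra_simps)
  qed simp
qed

subsection \<open>Calculus on the orthant\<close>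

lemma l1_norm_nonneg: "0 \<le> l1_norm x"
  by (simp add: l1_norm_def sum_nonneg)

lemma orthant_iff: "x \<in> orthant \<longleftrightarrow> (\<forall>i. 0 \<le> x $ i)"
  by (simp add: orthant_def less_eq_vec_def)

lemma lipschitz_l1_continuous_on:
  fixes h :: "real ^ 'a \<Rightarrow> real"
  assumes "lipschitz_l1 C h" "C \<ge> 0"
  shows "continuous_on orthant h"
proof (rule continuous_on_sequentiallyI)
  fix u and a :: "real ^ 'a" assume *: "\<forall>n. u n \<in> orthant" "a \<in> orthant" "u \<longlonglongrightarrow> a"
  have "(\<lambda>n. C * l1_norm (u n - a)) \<longlonglongrightarrow> C * (\<Sum>i\<in>UNIV. \<bar>a $ i - a $ i\<bar>)"
    unfolding l1_norm_def vector_minus_component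
    by (intro tendsto_intros *)
  then have lim: "(\<lambda>n. C * l1_norm (u n - a)) \<longlonglongrightarrow> 0" by simp
  have "(\<lambda>n. h (u n) - h a) \<longlonglongrightarrow> 0"
    by (rule Lim_null_comparison[OF _ lim]) (use * assms in \<open>auto simp: lipschitz_l1_def\<close>)
  then show "(\<lambda>n. h (u n)) \<longlonglongrightarrow> h a" by (simp add: LIM_zero_iff)
qed

text \<open>Uniqueness of one-sided derivatives needs this; the filter contains the right-hand one,
  so the boundary point 0 is covered too.\<close>

lemma at_within_nonneg_neq_bot:
  fixes s :: real
  assumes "s \<ge> 0"
  shows "at s within {0..} \<noteq> bot"
proof -
  have "at s within {s<..} \<le> at s within {0..}"
    by (rule at_le) (use assms in auto)
  then show ?thesis using trivial_limit_at_right_real[of s] by (auto simp: bot_unique)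
qed

lemma partial_deriv_eqI:
  assumes "x \<in> orthant" "(coord_section j h x has_real_derivative d) (at (x $ j) within {0..})"
  shows "partial_deriv j h x = d"
  unfolding partial_deriv_def
  by (rule vector_derivative_within)
    (use assms in \<open>auto simp: orthant_iff at_within_nonneg_neq_bot has_real_derivative_iff_has_vector_derivative\<close>)

lemma coord_section_has_partial_deriv:
  assumes "has_partials h" "x \<in> orthant"
  shows "(coord_section j h x has_real_derivative partial_deriv j h x) (at (x $ j) within {0..})"
  using assms unfolding has_partials_def partial_deriv_def has_real_derivative_iff_has_vector_derivative
  by (simp add: vector_derivative_works)

lemma C1_orthantI:
  assumes "\<And>j x. x \<in> orthant \<Longrightarrow> (coord_section j h x has_real_derivative G j x) (at (x $ j) within {0..})"
    and "\<And>j. continuous_on orthant (G j)"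
  shows "h \<in> C1_orthant"
proof -
  have "continuous_on orthant (partial_deriv j h)" for j
    by (rule continuous_on_cong[THEN iffD1, OF refl _ assms(2)[of j]])
      (simp add: partial_deriv_eqI[OF _ assms(1)])
  moreover have "has_partials h"
    unfolding has_partials_def using assms(1) real_differentiable_def by blast
  ultimately show ?thesis by (simp add: C1_orthant_def)
qed

lemma coord_section_in_orthant:
  assumes "x \<in> orthant" "0 \<le> s"
  shows "(\<chi> i. if i = j then s else x $ i) \<in> orthant"
  using assms by (simp add: orthant_iff)

lemma l1_norm_coord_diff:
  "l1_norm ((\<chi> i. if i = j then s else x $ i) - (\<chi> i. if i = j then t else x $ i)) = \<bar>s - t\<bar>"
proof -
  have "l1_norm ((\<chi> i. if i = j then s else x $ i) - (\<chi> i. if i = j then t else x $ i))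
      = (\<Sum>i\<in>UNIV. if i = j then \<bar>s - t\<bar> else 0)"
    unfolding l1_norm_def by (rule sum.cong) auto
  then show ?thesis by simp
qed

lemma abs_partial_deriv_le:
  assumes "has_partials h" "lipschitz_l1 C h" "x \<in> orthant"
  shows "\<bar>partial_deriv j h x\<bar> \<le> C"
proof (rule tendsto_upperbound)
  let ?q = "\<lambda>s. \<bar>(coord_section j h x s - coord_section j h x (x $ j)) / (s - x $ j)\<bar>"
  show "(?q \<longlongrightarrow> \<bar>partial_deriv j h x\<bar>) (at (x $ j) within {0..})"
    using coord_section_has_partial_deriv[OF assms(1,3), of j]
    by (intro tendsto_rabs) (simp add: has_field_derivative_iff)
  show "\<forall>\<^sub>F s in at (x $ j) within {0..}. ?q s \<le> C"
    unfolding eventually_at_filter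
  proof (rule always_eventually, safe)
    fix s :: real assume "0 \<le> s" "s \<noteq> x $ j"
    moreover have "0 \<le> x $ j" using assms by (simp add: orthant_iff)
    ultimately have "\<bar>coord_section j h x s - coord_section j h x (x $ j)\<bar>
        \<le> C * l1_norm ((\<chi> i. if i = j then s else x $ i) - (\<chi> i. if i = j then x $ j else x $ i))"
      using assms(2) coord_section_in_orthant[OF assms(3), of _ j]
      unfolding lipschitz_l1_def coord_section_def by blast
    then have "\<bar>coord_section j h x s - coord_section j h x (x $ j)\<bar> \<le> C * \<bar>s - x $ j\<bar>"
      by (simp only: l1_norm_coord_diff)
    then show "?q s \<le> C" using \<open>s \<noteq> x $ j\<close> by (simp add: abs_divide divide_le_eq)
  qed
  show "at (x $ j) within {0..} \<noteq> bot"
    using assms by (simp add: at_within_nonneg_neq_bot orthant_iff)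
qed

section \<open>Maxima of two scaled vectors\<close>

lemma sup_scaled_nth: "sup (a *\<^sub>R x) (b *\<^sub>R z) $ i = max (a * x $ i) (b * z $ i)"
  for x z :: "real ^ 'd"
  by (simp add: sup_vec_def sup_max)

lemma sup_scaled_in_orthant:
  assumes "0 \<le> a" "x \<in> orthant"
  shows "sup (a *\<^sub>R x) (b *\<^sub>R z) \<in> orthant"
  using assms by (simp add: orthant_iff sup_scaled_nth le_max_iff_disj)

lemma l1_norm_sup_scaled_diff:
  assumes "0 \<le> a"
  shows "l1_norm (sup (a *\<^sub>R x) (b *\<^sub>R z) - sup (a *\<^sub>R y) (b *\<^sub>R z)) \<le> a * l1_norm (x - y)"
  unfolding l1_norm_def sum_distrib_left
proof (rule sum_mono)
  fix i
  have "\<bar>max (a * x $ i) (b * z $ i) - max (a * y $ i) (b * z $ i)\<bar> \<le> \<bar>a * x $ i - a * y $ i\<bar>"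
    by linarith
  also have "\<dots> = a * \<bar>x $ i - y $ i\<bar>"
    using assms by (simp add: abs_mult flip: right_diff_distrib)
  finally show "\<bar>(sup (a *\<^sub>R x) (b *\<^sub>R z) - sup (a *\<^sub>R y) (b *\<^sub>R z)) $ i\<bar> \<le> a * \<bar>(x - y) $ i\<bar>"
    by (simp add: sup_scaled_nth)
qed

text \<open>Only coordinate \<open>j\<close> of the maximum reacts to \<open>s\<close>, which
  reduces differentiation to one section of \<open>h\<close> composed with
  \<open>max (a * s) (b * z $ j)\<close>.\<close>

lemma sup_scaled_coord:
  "sup (a *\<^sub>R (\<chi> i. if i = j then s else x $ i)) (b *\<^sub>R z)
    = (\<chi> i. if i = j then max (a * s) (b * z $ j) else sup (a *\<^sub>R x) (b *\<^sub>R z) $ i)"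
  by (simp add: vec_eq_iff sup_scaled_nth)

text \<open>
  At \<open>b * z $ j = a * x $ j\<close> the section below has a kink; this happens with probability zero.
\<close>

lemma coord_section_sup_scaled_deriv:
  assumes h: "has_partials h" and ab: "0 < a" and x: "x \<in> orthant" and ne: "b * z $ j \<noteq> a * x $ j"
  shows "((\<lambda>s. h (sup (a *\<^sub>R (\<chi> i. if i = j then s else x $ i)) (b *\<^sub>R z))) has_real_derivative
      a * (partial_deriv j h (sup (a *\<^sub>R x) (b *\<^sub>R z)) * indicator {z. b * z $ j \<le> a * x $ j} z))
      (at (x $ j) within {0..})"
proof -
  define m where "m = sup (a *\<^sub>R x) (b *\<^sub>R z)"
  \<comment> \<open>Moving \<open>x $ j\<close> by less than \<open>d\<close> moves
    \<open>a * x $ j\<close> by less than its distance to \<open>b * z $ j\<close>, so the same term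
    keeps attaining the maximum.\<close>
  define d where "d = \<bar>a * x $ j - b * z $ j\<bar> / a"
  have "d > 0" using ne ab by (simp add: d_def)
  have xj: "x $ j \<in> {0..}" using x by (simp add: orthant_iff)
  have m: "m \<in> orthant" unfolding m_def using ab x by (intro sup_scaled_in_orthant) auto
  have near: "\<bar>a * s - a * x $ j\<bar> < \<bar>a * x $ j - b * z $ j\<bar>" if "dist s (x $ j) < d" for s
  proof -
    have "a * \<bar>s - x $ j\<bar> < \<bar>a * x $ j - b * z $ j\<bar>"
      using that ab by (simp add: d_def dist_real_def pos_less_divide_eq mult.commute)
    then show ?thesis using ab by (simp add: abs_mult flip: right_diff_distrib)
  qed
  have eq: "h (sup (a *\<^sub>R (\<chi> i. if i = j then s else x $ i)) (b *\<^sub>R z))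
      = coord_section j h m (max (a * s) (b * z $ j))" for s
    by (simp add: sup_scaled_coord coord_section_def m_def)
  show ?thesis
  proof (cases "b * z $ j < a * x $ j")
    case True
    then have "m $ j = a * x $ j" by (simp add: m_def sup_scaled_nth)
    then have "(coord_section j h m has_real_derivative partial_deriv j h m) (at (a * x $ j) within {0..})"
      using coord_section_has_partial_deriv[OF h m, of j] by simp
    \<comment> \<open>The chain rule for multiplication by \<open>a\<close> asks for a derivative
      within the image of the half-line, a subset of \<open>{0..}\<close>.\<close>
    then have "(coord_section j h m has_real_derivative partial_deriv j h m)
        (at (a * x $ j) within (\<lambda>s. a * s) ` {0..})"
      by (rule DERIV_subset) (use ab in auto)
    then have "(coord_section j h m \<circ> (\<lambda>s. a * s) has_real_derivative partial_deriv j h m * a)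
        (at (x $ j) within {0..})"
      by (rule DERIV_image_chain) (auto intro!: derivative_eq_intros)
    then have "((\<lambda>s. h (sup (a *\<^sub>R (\<chi> i. if i = j then s else x $ i)) (b *\<^sub>R z))) has_real_derivative
        partial_deriv j h m * a) (at (x $ j) within {0..})"
    proof (rule has_field_derivative_transform_within[OF _ \<open>d > 0\<close> xj])
      fix s assume "s \<in> {0..}" "dist s (x $ j) < d"
      then have "max (a * s) (b * z $ j) = a * s" using near[of s] True by linarith
      then show "(coord_section j h m \<circ> (\<lambda>s. a * s)) s
          = h (sup (a *\<^sub>R (\<chi> i. if i = j then s else x $ i)) (b *\<^sub>R z))"
        by (simp add: eq)
    qed
    then show ?thesis using True by (simp add: m_def mult.commute)
  next
    case False
    have "((\<lambda>s. coord_section j h m (b * z $ j)) has_real_derivative 0) (at (x $ j) within {0..})"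
      by simp
    then have "((\<lambda>s. h (sup (a *\<^sub>R (\<chi> i. if i = j then s else x $ i)) (b *\<^sub>R z))) has_real_derivative 0)
        (at (x $ j) within {0..})"
    proof (rule has_field_derivative_transform_within[OF _ \<open>d > 0\<close> xj])
      fix s assume "s \<in> {0..}" "dist s (x $ j) < d"
      then have "max (a * s) (b * z $ j) = b * z $ j" using near[of s] False by linarith
      then show "coord_section j h m (b * z $ j)
          = h (sup (a *\<^sub>R (\<chi> i. if i = j then s else x $ i)) (b *\<^sub>R z))"
        by (simp add: eq)
    qed
    then show ?thesis using False ne by (simp add: indicator_def)
  qed
qed

subsection \<open>Smoothing by a vector with Frechet margins\<close>

locale frechet_margins = prob_space D for D :: "(real ^ 'd) measure" +
  fixes \<alpha> :: real
  assumes alpha_gt_1: "\<alpha> > 1"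
    and sets_D: "sets D = sets (restrict_space borel open_orthant)"
    and margin: "0 < s \<Longrightarrow> prob {y \<in> open_orthant. y $ j \<le> s} = exp (- (s powr (- \<alpha>)))"
begin

lemma space_D: "space D = open_orthant"
  using sets_eq_imp_space_eq[OF sets_D] by (simp add: space_restrict_space)

lemma borel_measurable_D: "f \<in> borel_measurable borel \<Longrightarrow> f \<in> borel_measurable D"
  using measurable_cong_sets[OF sets_D refl] by (auto intro: measurable_restrict_space1)

lemma measurable_nth [measurable]: "(\<lambda>z. z $ i) \<in> borel_measurable D"
  by (intro borel_measurable_D borel_measurable_continuous_onI continuous_intros)

lemma prob_nth_le: "prob {y \<in> space D. y $ j \<le> s} = frechet_cdf \<alpha> s"
proof (cases "s \<le> 0")
  case True
  then have empty: "{y \<in> space D. y $ j \<le> s} = {}"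
    by (auto simp: space_D open_orthant_def) (meson not_le order_trans)
  show ?thesis unfolding empty using True by (simp add: frechet_cdf_def)
qed (simp add: margin space_D frechet_cdf_def)

lemma prob_nth_Ioc:
  assumes "s \<le> t"
  shows "prob {y \<in> space D. s < y $ j \<and> y $ j \<le> t} = frechet_cdf \<alpha> t - frechet_cdf \<alpha> s"
proof -
  have "prob ({y \<in> space D. y $ j \<le> t} - {y \<in> space D. y $ j \<le> s})
      = frechet_cdf \<alpha> t - frechet_cdf \<alpha> s"
    unfolding prob_nth_le[symmetric, of _ j]
    by (rule finite_measure_Diff) (use assms in auto)
  also have "{y \<in> space D. y $ j \<le> t} - {y \<in> space D. y $ j \<le> s}
      = {y \<in> space D. s < y $ j \<and> y $ j \<le> t}" by auto
  finally show ?thesis .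
qed

text \<open>For \<open>s > 0\<close> the point lies in the interval from \<open>s - d\<close> to
  \<open>s\<close>, whose probability is at most \<open>\<alpha> * d\<close> by
  \<open>frechet_cdf_increment\<close>, with \<open>d\<close> arbitrarily small.\<close>

lemma AE_nth_neq: "AE z in D. z $ j \<noteq> s"
proof (cases "s \<le> 0")
  case True
  then show ?thesis by (intro AE_I2) (auto simp: space_D open_orthant_def dest: spec[of _ j])
next
  case False
  have "prob {z \<in> space D. z $ j = s} \<le> 0 + e" if "e > 0" for e
  proof -
    \<comment> \<open>The cap at \<open>s\<close> keeps \<open>s - d\<close> nonnegative, as the
      increment bound demands.\<close>
    define d where "d = min s (e / \<alpha>)"
    have d: "0 < d" "d \<le> s" "\<alpha> * d \<le> e"
      using False that alpha_gt_1 by (auto simp: d_def min_def field_simps)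
    have "prob {z \<in> space D. z $ j = s} \<le> prob {z \<in> space D. s - d < z $ j \<and> z $ j \<le> s}"
      by (rule finite_measure_mono) (use d in auto)
    also have "\<dots> = frechet_cdf \<alpha> s - frechet_cdf \<alpha> (s - d)"
      by (rule prob_nth_Ioc) (use d in auto)
    also have "\<dots> \<le> \<alpha> * d"
    proof -
      have "0 \<le> d * frechet_cdf \<alpha> (s - d)" using d frechet_cdf_nonneg by simp
      then show ?thesis using frechet_cdf_increment[of \<alpha> "s - d" s] d alpha_gt_1 by simp
    qed
    finally show ?thesis using d by simp
  qed
  then have "prob {z \<in> space D. z $ j = s} \<le> 0"
    by (rule field_le_epsilon)
  then have "prob {z \<in> space D. z $ j = s} = 0"
    by (simp add: measure_le_0_iff)
  then have "{z \<in> space D. z $ j = s} \<in> null_sets D"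
    by (auto simp: null_sets_def emeasure_eq_measure)
  then show ?thesis by (auto intro: AE_I')
qed

text \<open>
  A nonnegative variable \<open>X\<close> is at most the number of \<open>n\<close> with \<open>n < X\<close>, and the probability of
  \<open>n < z $ j\<close> is at most \<open>n powr - \<alpha>\<close>, which is summable.
\<close>

lemma integrable_nth: "integrable D (\<lambda>z. z $ j)"
proof (rule integrableI_nonneg)
  show "AE z in D. 0 \<le> z $ j"
    by (intro AE_I2) (auto simp: space_D open_orthant_def intro: less_imp_le)
  let ?A = "\<lambda>n. {z \<in> space D. real n < z $ j}"
  have "(\<integral>\<^sup>+z. ennreal (z $ j) \<partial>D) \<le> (\<integral>\<^sup>+z. (\<Sum>n. indicator (?A n) z) \<partial>D)"
  proof (rule nn_integral_mono)
    fix z assume z: "z \<in> space D"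
    define k where "k = nat \<lceil>z $ j\<rceil>"
    have pos: "z $ j > 0" using z by (simp add: space_D open_orthant_def)
    then have "z $ j \<le> real k" by (simp add: k_def)
    have "(\<Sum>n<k. indicator (?A n) z) = (\<Sum>n<k. 1 :: ennreal)"
    proof (rule sum.cong)
      fix n assume "n \<in> {..<k}"
      then have "real n < z $ j" using pos unfolding k_def by simp linarith
      then show "indicator (?A n) z = (1 :: ennreal)" using z by simp
    qed simp
    then have "ennreal (z $ j) \<le> (\<Sum>n<k. indicator (?A n) z)"
      using \<open>z $ j \<le> real k\<close> by (simp add: ennreal_of_nat_eq_real_of_nat)
    also have "\<dots> \<le> (\<Sum>n. indicator (?A n) z)" by (rule sum_le_suminf) auto
    finally show "ennreal (z $ j) \<le> (\<Sum>n. indicator (?A n) z)" .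
  qed
  also have "\<dots> = (\<Sum>n. emeasure D (?A n))"
    by (subst nn_integral_suminf) auto
  also have "\<dots> = (\<Sum>n. ennreal (prob (?A n)))" by (simp add: emeasure_eq_measure)
  also have "\<dots> < \<infinity>"
  proof -
    \<comment> \<open>At \<open>n = 0\<close> the bound fails, the probability being 1 and
      \<open>0 powr _\<close> being 0; summability only needs it eventually.\<close>
    have tail: "prob (?A n) \<le> real n powr (- \<alpha>)" if "n \<ge> 1" for n
    proof -
      have "prob (space D - {z \<in> space D. z $ j \<le> real n}) = 1 - frechet_cdf \<alpha> (real n)"
        by (subst prob_compl) (auto simp: prob_nth_le)
      also have "space D - {z \<in> space D. z $ j \<le> real n} = ?A n" by auto
      also have "1 - frechet_cdf \<alpha> (real n) \<le> real n powr (- \<alpha>)"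
        using that exp_ge_add_one_self[of "- (real n powr (- \<alpha>))"] by (simp add: frechet_cdf_def)
      finally show ?thesis .
    qed
    have "summable (\<lambda>n. real n powr (- \<alpha>))" using alpha_gt_1 by (simp add: summable_real_powr_iff)
    then have "summable (\<lambda>n. prob (?A n))"
      by (rule summable_comparison_test_ev[rotated])
        (use tail in \<open>auto simp: eventually_sequentially\<close>)
    then show ?thesis
      by (simp add: suminf_ennreal2)
  qed
  finally show "(\<integral>\<^sup>+z. ennreal (z $ j) \<partial>D) < \<infinity>" .
qed simp

text \<open>Since \<open>g\<close> is controlled on the orthant only, the maximum is first shown to
  be measurable into that subspace.\<close>

lemma measurable_sup_scaled:
  assumes "0 \<le> a" "x \<in> orthant" "continuous_on orthant g"
  shows "(\<lambda>z. g (sup (a *\<^sub>R x) (b *\<^sub>R z))) \<in> borel_measurable D"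
proof -
  have "continuous_on UNIV (\<lambda>z. sup (a *\<^sub>R x) (b *\<^sub>R z))"
    unfolding sup_vec_def sup_max by (intro continuous_intros)
  then have "(\<lambda>z. sup (a *\<^sub>R x) (b *\<^sub>R z)) \<in> borel_measurable D"
    by (intro borel_measurable_D borel_measurable_continuous_onI)
  then have "(\<lambda>z. sup (a *\<^sub>R x) (b *\<^sub>R z)) \<in> D \<rightarrow>\<^sub>M restrict_space borel orthant"
    by (rule measurable_restrict_space2[rotated]) (use assms sup_scaled_in_orthant in auto)
  then show ?thesis
    by (rule measurable_compose[OF _ borel_measurable_continuous_on_restrict[OF assms(3)]])
qed

text \<open>A Lipschitz function grows at most linearly, and the coordinates of \<open>z\<close> are
  integrable.\<close>

lemma integrable_sup_scaled:
  assumes "0 \<le> a" "0 \<le> b" "x \<in> orthant" "lipschitz_l1 1 h"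
  shows "integrable D (\<lambda>z. h (sup (a *\<^sub>R x) (b *\<^sub>R z)))"
proof (rule Bochner_Integration.integrable_bound)
  show "integrable D (\<lambda>z. \<bar>h 0\<bar> + (\<Sum>i\<in>UNIV. a * x $ i + b * z $ i))"
    by (intro Bochner_Integration.integrable_add Bochner_Integration.integrable_sum
        integrable_const integrable_mult_right integrable_nth)
  show "(\<lambda>z. h (sup (a *\<^sub>R x) (b *\<^sub>R z))) \<in> borel_measurable D"
    by (rule measurable_sup_scaled[OF assms(1,3) lipschitz_l1_continuous_on[OF assms(4)]]) simp
  show "AE z in D. norm (h (sup (a *\<^sub>R x) (b *\<^sub>R z)))
      \<le> norm (\<bar>h 0\<bar> + (\<Sum>i\<in>UNIV. a * x $ i + b * z $ i))"
  proof (rule AE_I2)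
    fix z assume "z \<in> space D"
    then have z: "0 \<le> z $ i" for i by (simp add: space_D open_orthant_def less_imp_le)
    have x: "0 \<le> x $ i" for i using assms(3) by (simp add: orthant_iff)
    have "\<bar>h (sup (a *\<^sub>R x) (b *\<^sub>R z)) - h 0\<bar> \<le> l1_norm (sup (a *\<^sub>R x) (b *\<^sub>R z))"
    proof -
      have "(0 :: real ^ 'd) \<in> orthant" by (simp add: orthant_iff)
      with assms(4) sup_scaled_in_orthant[OF assms(1,3), of b z]
      have "\<bar>h (sup (a *\<^sub>R x) (b *\<^sub>R z)) - h 0\<bar> \<le> 1 * l1_norm (sup (a *\<^sub>R x) (b *\<^sub>R z) - 0)"
        unfolding lipschitz_l1_def by blast
      then show ?thesis by simp
    qed
    also have "\<dots> \<le> (\<Sum>i\<in>UNIV. a * x $ i + b * z $ i)"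
      unfolding l1_norm_def sup_scaled_nth
      by (rule sum_mono) (use x z assms in \<open>auto simp: max_def abs_of_nonneg\<close>)
    finally show "norm (h (sup (a *\<^sub>R x) (b *\<^sub>R z)))
        \<le> norm (\<bar>h 0\<bar> + (\<Sum>i\<in>UNIV. a * x $ i + b * z $ i))" by simp
  qed
qed

section \<open>The smoothed function and its partial derivatives\<close>

definition smoothed :: "real \<Rightarrow> real \<Rightarrow> (real ^ 'd \<Rightarrow> real) \<Rightarrow> real ^ 'd \<Rightarrow> real" where
  "smoothed a b h x = (\<integral>z. h (sup (a *\<^sub>R x) (b *\<^sub>R z)) \<partial>D)"

text \<open>With \<open>g\<close> the \<open>j\<close>-th partial derivative of \<open>h\<close>,
  this is the candidate for that of \<open>smoothed a b h\<close>: the factor \<open>a\<close> comes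
  from the chain rule, and the indicator selects where coordinate \<open>j\<close> of the maximum
  depends on \<open>x\<close>.\<close>

definition smoothed_partial :: "real \<Rightarrow> real \<Rightarrow> (real ^ 'd \<Rightarrow> real) \<Rightarrow> 'd \<Rightarrow> real ^ 'd \<Rightarrow> real" where
  "smoothed_partial a b g j x =
    (\<integral>z. a * (g (sup (a *\<^sub>R x) (b *\<^sub>R z)) * indicator {z. b * z $ j \<le> a * x $ j} z) \<partial>D)"

text \<open>Taking the maximum with a common vector does not increase distances. The constant
  \<open>a\<close> serves both Lipschitz claims of the first part.\<close>

lemma smoothed_lipschitz:
  assumes "0 \<le> a" "0 \<le> b" "lipschitz_l1 1 h"
  shows "lipschitz_l1 a (smoothed a b h)"
  unfolding lipschitz_l1_def
proof safe
  fix x y :: "real ^ 'd" assume x: "x \<in> orthant" and y: "y \<in> orthant"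
  note int = integrable_sup_scaled[OF assms(1,2) x assms(3)] integrable_sup_scaled[OF assms(1,2) y assms(3)]
  have "\<bar>smoothed a b h x - smoothed a b h y\<bar>
      = norm (\<integral>z. h (sup (a *\<^sub>R x) (b *\<^sub>R z)) - h (sup (a *\<^sub>R y) (b *\<^sub>R z)) \<partial>D)"
    unfolding smoothed_def by (subst Bochner_Integration.integral_diff[OF int]) simp
  also have "\<dots> \<le> (\<integral>z. a * l1_norm (x - y) \<partial>D)"
  proof (rule Bochner_Integration.integral_norm_bound_integral)
    fix z
    have "\<bar>h (sup (a *\<^sub>R x) (b *\<^sub>R z)) - h (sup (a *\<^sub>R y) (b *\<^sub>R z))\<bar>
        \<le> 1 * l1_norm (sup (a *\<^sub>R x) (b *\<^sub>R z) - sup (a *\<^sub>R y) (b *\<^sub>R z))"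
      using assms(3) sup_scaled_in_orthant[OF assms(1) x] sup_scaled_in_orthant[OF assms(1) y]
      unfolding lipschitz_l1_def by blast
    also have "\<dots> \<le> a * l1_norm (x - y)" using l1_norm_sup_scaled_diff[OF assms(1)] by simp
    finally show "norm (h (sup (a *\<^sub>R x) (b *\<^sub>R z)) - h (sup (a *\<^sub>R y) (b *\<^sub>R z))) \<le> a * l1_norm (x - y)"
      by simp
  qed (use int in auto)
  finally show "\<bar>smoothed a b h x - smoothed a b h y\<bar> \<le> a * l1_norm (x - y)"
    by (simp add: prob_space)
qed

lemma AE_no_tie:
  assumes "0 < b"
  shows "AE z in D. b * z $ j \<noteq> c"
  using AE_nth_neq[of j "c / b"] by eventually_elim (use assms in \<open>auto simp: nonzero_eq_divide_eq mult.commute\<close>)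

lemma smoothed_partial_measurable:
  assumes "0 \<le> a" "x \<in> orthant" "continuous_on orthant g"
  shows "(\<lambda>z. a * (g (sup (a *\<^sub>R x) (b *\<^sub>R z)) * indicator {z. b * z $ j \<le> a * x $ j} z)) \<in> borel_measurable D"
proof -
  have "(\<lambda>z. indicator {z. b * z $ j \<le> a * x $ j} z :: real)
      = (\<lambda>z. if b * z $ j \<le> a * x $ j then 1 else 0)" by (auto simp: indicator_def)
  then have [measurable]: "(\<lambda>z. indicator {z. b * z $ j \<le> a * x $ j} z :: real) \<in> borel_measurable D"
    by simp
  show ?thesis using measurable_sup_scaled[OF assms, of b] by measurable
qed

text \<open>The difference quotients are bounded by \<open>a\<close> uniformly in \<open>z\<close>
  and converge away from ties, so the limit passes under the integral.\<close>

lemma smoothed_has_partial: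
  assumes ab: "0 < a" "0 < b" and h: "h \<in> C1_orthant" "lipschitz_l1 1 h" and x: "x \<in> orthant"
  shows "(coord_section j (smoothed a b h) x has_real_derivative
      smoothed_partial a b (partial_deriv j h) j x) (at (x $ j) within {0..})"
proof -
  let ?m = "\<lambda>s z. sup (a *\<^sub>R (\<chi> i. if i = j then s else x $ i)) (b *\<^sub>R z)"
  have P: "has_partials h" and cont: "continuous_on orthant (partial_deriv j h)"
    using h by (auto simp: C1_orthant_def)
  have upd: "(\<chi> i. if i = j then x $ j else x $ i) = x" by (simp add: vec_eq_iff)
  have x0: "0 \<le> x $ j" using x by (simp add: orthant_iff)
  have int: "integrable D (\<lambda>z. h (?m s z))" if "0 \<le> s" for s
    using ab h coord_section_in_orthant[OF x that] by (intro integrable_sup_scaled) auto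
  have bound: "\<bar>h (?m s z) - h (?m (x $ j) z)\<bar> \<le> a * \<bar>s - x $ j\<bar>" if "0 \<le> s" for s z
  proof -
    have "\<bar>h (?m s z) - h (?m (x $ j) z)\<bar> \<le> 1 * l1_norm (?m s z - ?m (x $ j) z)"
      using h(2) ab coord_section_in_orthant[OF x that] coord_section_in_orthant[OF x x0]
      unfolding lipschitz_l1_def by (meson less_imp_le sup_scaled_in_orthant)
    also have "\<dots> \<le> a * l1_norm ((\<chi> i. if i = j then s else x $ i) - (\<chi> i. if i = j then x $ j else x $ i))"
      using l1_norm_sup_scaled_diff[OF less_imp_le[OF ab(1)]] by simp
    finally show ?thesis by (simp only: l1_norm_coord_diff)
  qed
  \<comment> \<open>Dominated convergence concerns sequences, so the limit is tested along sequences
    \<open>X\<close> that avoid \<open>x $ j\<close>.\<close>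
  have "(\<lambda>n. (coord_section j (smoothed a b h) x (X n) - coord_section j (smoothed a b h) x (x $ j)) / (X n - x $ j))
      \<longlonglongrightarrow> smoothed_partial a b (partial_deriv j h) j x"
    if X: "\<And>n. X n \<in> {0..} - {x $ j}" "X \<longlonglongrightarrow> x $ j" for X
  proof -
    have X0: "0 \<le> X n" "X n \<noteq> x $ j" for n using X(1)[of n] by auto
    have "(\<lambda>n. (coord_section j (smoothed a b h) x (X n) - coord_section j (smoothed a b h) x (x $ j)) / (X n - x $ j))
        = (\<lambda>n. \<integral>z. (h (?m (X n) z) - h (?m (x $ j) z)) / (X n - x $ j) \<partial>D)"
      unfolding coord_section_def smoothed_def
      by (simp only: integral_divide_zero Bochner_Integration.integral_diff[OF int[OF X0(1)] int[OF x0]])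
    moreover have "(\<lambda>n. \<integral>z. (h (?m (X n) z) - h (?m (x $ j) z)) / (X n - x $ j) \<partial>D)
        \<longlonglongrightarrow> smoothed_partial a b (partial_deriv j h) j x"
      unfolding smoothed_partial_def
    proof (rule integral_dominated_convergence)
      show "(\<lambda>z. a * (partial_deriv j h (sup (a *\<^sub>R x) (b *\<^sub>R z)) * indicator {z. b * z $ j \<le> a * x $ j} z))
          \<in> borel_measurable D"
        using ab x cont by (intro smoothed_partial_measurable) auto
      show "(\<lambda>z. (h (?m (X n) z) - h (?m (x $ j) z)) / (X n - x $ j)) \<in> borel_measurable D" for n
        using int[OF X0(1)[of n]] int[OF x0] by (intro borel_measurable_divide borel_measurable_diff) auto
      show "integrable D (\<lambda>z. a)" by simp
      show "AE z in D. norm ((h (?m (X n) z) - h (?m (x $ j) z)) / (X n - x $ j)) \<le> a" for n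
        using bound[OF X0(1)] X0(2) by (auto simp: abs_divide divide_le_eq)
      show "AE z in D. (\<lambda>n. (h (?m (X n) z) - h (?m (x $ j) z)) / (X n - x $ j)) \<longlonglongrightarrow>
          a * (partial_deriv j h (sup (a *\<^sub>R x) (b *\<^sub>R z)) * indicator {z. b * z $ j \<le> a * x $ j} z)"
        using AE_no_tie[OF ab(2), of j "a * x $ j"]
      proof eventually_elim
        case (elim z)
        show ?case
          using coord_section_sup_scaled_deriv[OF P ab(1) x elim] X
          unfolding has_field_derivative_iff tendsto_at_iff_sequentially comp_def by blast
      qed
    qed
    ultimately show ?thesis by (simp only:)
  qed
  then show ?thesis
    unfolding has_field_derivative_iff tendsto_at_iff_sequentially comp_def by blast
qed

text \<open>Away from ties at the limit point the indicator is eventually constant along the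
  sequence, so the integrands converge; the constant \<open>a\<close> dominates them.\<close>

lemma smoothed_partial_continuous:
  assumes ab: "0 < a" "0 < b" and g: "continuous_on orthant g" "\<And>x. x \<in> orthant \<Longrightarrow> \<bar>g x\<bar> \<le> 1"
  shows "continuous_on orthant (smoothed_partial a b g j)"
proof (rule continuous_on_sequentiallyI)
  fix u and x :: "real ^ 'd" assume u: "\<forall>n. u n \<in> orthant" "x \<in> orthant" "u \<longlonglongrightarrow> x"
  show "(\<lambda>n. smoothed_partial a b g j (u n)) \<longlonglongrightarrow> smoothed_partial a b g j x"
    unfolding smoothed_partial_def
  proof (rule integral_dominated_convergence)
    show "(\<lambda>z. a * (g (sup (a *\<^sub>R x) (b *\<^sub>R z)) * indicator {z. b * z $ j \<le> a * x $ j} z)) \<in> borel_measurable D"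
      using ab u g by (intro smoothed_partial_measurable) auto
    show "(\<lambda>z. a * (g (sup (a *\<^sub>R u n) (b *\<^sub>R z)) * indicator {z. b * z $ j \<le> a * u n $ j} z)) \<in> borel_measurable D" for n
      using ab u g by (intro smoothed_partial_measurable) auto
    show "integrable D (\<lambda>z. a)" by simp
    show "AE z in D. norm (a * (g (sup (a *\<^sub>R u n) (b *\<^sub>R z)) * indicator {z. b * z $ j \<le> a * u n $ j} z)) \<le> a" for n
      using ab u g(2)[OF sup_scaled_in_orthant] by (auto simp: abs_mult indicator_def)
    show "AE z in D. (\<lambda>n. a * (g (sup (a *\<^sub>R u n) (b *\<^sub>R z)) * indicator {z. b * z $ j \<le> a * u n $ j} z))
        \<longlonglongrightarrow> a * (g (sup (a *\<^sub>R x) (b *\<^sub>R z)) * indicator {z. b * z $ j \<le> a * x $ j} z)"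
      using AE_no_tie[OF ab(2), of j "a * x $ j"]
    proof eventually_elim
      case (elim z)
      have "(\<lambda>n. sup (a *\<^sub>R u n) (b *\<^sub>R z)) \<longlonglongrightarrow> sup (a *\<^sub>R x) (b *\<^sub>R z)"
        unfolding sup_vec_def sup_max by (intro vec_tendstoI) (auto intro!: tendsto_intros u(3))
      then have 1: "(\<lambda>n. g (sup (a *\<^sub>R u n) (b *\<^sub>R z))) \<longlonglongrightarrow> g (sup (a *\<^sub>R x) (b *\<^sub>R z))"
        by (rule continuous_on_tendsto_compose[OF g(1)])
          (use ab u in \<open>auto simp: sup_scaled_in_orthant\<close>)
      have lim: "(\<lambda>n. a * u n $ j) \<longlonglongrightarrow> a * x $ j" by (intro tendsto_intros u(3))
      have "\<forall>\<^sub>F n in sequentially. indicator {z. b * z $ j \<le> a * u n $ j} z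
          = (indicator {z. b * z $ j \<le> a * x $ j} z :: real)"
      proof (cases "b * z $ j < a * x $ j")
        case True
        show ?thesis using order_tendstoD(1)[OF lim True] by eventually_elim (use True in \<open>auto simp: indicator_def\<close>)
      next
        case False
        then have "a * x $ j < b * z $ j" using elim by simp
        from order_tendstoD(2)[OF lim this] show ?thesis
          by eventually_elim (use False elim in \<open>auto simp: indicator_def\<close>)
      qed
      then have "(\<lambda>n. indicator {z. b * z $ j \<le> a * u n $ j} z)
          \<longlonglongrightarrow> (indicator {z. b * z $ j \<le> a * x $ j} z :: real)"
        by (rule tendsto_eventually)
      with 1 show ?case by (intro tendsto_intros)
    qed
  qed
qed

lemma smoothed_in_C1:
  assumes "0 < a" "0 < b" "h \<in> C1_orthant" "lipschitz_l1 1 h"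
  shows "smoothed a b h \<in> C1_orthant"
    and "x \<in> orthant \<Longrightarrow> partial_deriv j (smoothed a b h) x = smoothed_partial a b (partial_deriv j h) j x"
proof -
  show "smoothed a b h \<in> C1_orthant"
    by (rule C1_orthantI[OF smoothed_has_partial[OF assms] smoothed_partial_continuous])
      (use assms abs_partial_deriv_le[OF _ assms(4)] in \<open>auto simp: C1_orthant_def\<close>)
  show "x \<in> orthant \<Longrightarrow> partial_deriv j (smoothed a b h) x = smoothed_partial a b (partial_deriv j h) j x"
    by (rule partial_deriv_eqI[OF _ smoothed_has_partial[OF assms]])
qed

section \<open>Quantitative bounds on the partial derivatives\<close>

lemma prob_no_exceedance:
  assumes "0 < b"
  shows "prob {z \<in> space D. b * z $ j \<le> a * x $ j} = frechet_cdf \<alpha> (a / b * x $ j)"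
proof -
  have "{z \<in> space D. b * z $ j \<le> a * x $ j} = {z \<in> space D. z $ j \<le> a / b * x $ j}"
    using assms by (auto simp: pos_le_divide_eq mult.commute)
  then show ?thesis by (simp add: prob_nth_le)
qed

lemma integrable_smoothed_partial:
  assumes ab: "0 < a" and g: "continuous_on orthant g" "\<And>x. x \<in> orthant \<Longrightarrow> \<bar>g x\<bar> \<le> 1" and x: "x \<in> orthant"
  shows "integrable D (\<lambda>z. a * (g (sup (a *\<^sub>R x) (b *\<^sub>R z)) * indicator {z. b * z $ j \<le> a * x $ j} z))"
proof (rule integrable_const_bound[where B = a])
  show "AE z in D. norm (a * (g (sup (a *\<^sub>R x) (b *\<^sub>R z)) * indicator {z. b * z $ j \<le> a * x $ j} z)) \<le> a"
    using ab x g(2)[OF sup_scaled_in_orthant] by (auto simp: abs_mult indicator_def)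
qed (intro smoothed_partial_measurable less_imp_le[OF ab] x g(1))

lemma smoothed_partial_bound:
  assumes ab: "0 < a" "0 < b"
    and g: "continuous_on orthant g" "\<And>x. x \<in> orthant \<Longrightarrow> \<bar>g x\<bar> \<le> 1"
    and x: "x \<in> orthant"
  shows "\<bar>smoothed_partial a b g j x\<bar> \<le> a * frechet_cdf \<alpha> (a / b * x $ j)"
proof -
  let ?A = "{z \<in> space D. b * z $ j \<le> a * x $ j}"
  have "norm (smoothed_partial a b g j x) \<le> (\<integral>z. a * indicator ?A z \<partial>D)"
    unfolding smoothed_partial_def
  proof (rule Bochner_Integration.integral_norm_bound_integral)
    fix z assume "z \<in> space D"
    have "\<bar>g (sup (a *\<^sub>R x) (b *\<^sub>R z))\<bar> \<le> 1" using ab x by (intro g(2) sup_scaled_in_orthant) auto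
    then show "norm (a * (g (sup (a *\<^sub>R x) (b *\<^sub>R z)) * indicator {z. b * z $ j \<le> a * x $ j} z)) \<le> a * indicator ?A z"
      using ab \<open>z \<in> space D\<close> by (auto simp: abs_mult indicator_def)
  next
    show "integrable D (\<lambda>z. a * indicator ?A z)" by (auto simp: emeasure_eq_measure)
  qed (rule integrable_smoothed_partial[OF ab(1) g x])
  also have "\<dots> = a * prob ?A" by simp
  finally show ?thesis by (simp add: prob_no_exceedance[OF ab(2)])
qed

text \<open>The event at \<open>x\<close> is contained in the event at \<open>y\<close>. On the
  smaller one the Lipschitz bound for \<open>g\<close> applies; on the difference only the term at
  \<open>y\<close> survives, and it is at most \<open>a\<close>; elsewhere both terms
  vanish.\<close>

lemma smoothed_partial_diff:
  assumes ab: "0 < a" "0 < b"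
    and g: "lipschitz_l1 1 g" "\<And>x. x \<in> orthant \<Longrightarrow> \<bar>g x\<bar> \<le> 1"
    and x: "x \<in> orthant" and y: "y \<in> orthant" and le: "x $ j \<le> y $ j"
  shows "\<bar>smoothed_partial a b g j x - smoothed_partial a b g j y\<bar>
    \<le> a * (a * l1_norm (x - y)) * frechet_cdf \<alpha> (a / b * x $ j)
      + a * (frechet_cdf \<alpha> (a / b * y $ j) - frechet_cdf \<alpha> (a / b * x $ j))"
proof -
  let ?A = "\<lambda>x. {z \<in> space D. b * z $ j \<le> a * x $ j}"
  let ?f = "\<lambda>x z. a * (g (sup (a *\<^sub>R x) (b *\<^sub>R z)) * indicator {z. b * z $ j \<le> a * x $ j} z)"
  let ?B = "\<lambda>z. a * (a * l1_norm (x - y)) * indicator (?A x) z + a * (indicator (?A y) z - indicator (?A x) z)"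
  have cont: "continuous_on orthant g" using lipschitz_l1_continuous_on[OF g(1)] by simp
  note int = integrable_smoothed_partial[OF ab(1) cont g(2) x, where b = b and j = j]
    integrable_smoothed_partial[OF ab(1) cont g(2) y, where b = b and j = j]
  have ind: "integrable D (indicator (?A x) :: _ \<Rightarrow> real)" for x :: "real ^ 'd"
    by (auto simp: emeasure_eq_measure)
  have "\<bar>smoothed_partial a b g j x - smoothed_partial a b g j y\<bar> = norm (\<integral>z. ?f x z - ?f y z \<partial>D)"
    unfolding smoothed_partial_def by (simp only: Bochner_Integration.integral_diff[OF int] real_norm_def)
  also have "\<dots> \<le> (\<integral>z. ?B z \<partial>D)"
  proof (rule Bochner_Integration.integral_norm_bound_integral)
    show "integrable D (\<lambda>z. ?f x z - ?f y z)" using int by (rule Bochner_Integration.integrable_diff)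
    show "integrable D ?B"
      using ind by (intro Bochner_Integration.integrable_add Bochner_Integration.integrable_diff integrable_mult_right)
    fix z assume z: "z \<in> space D"
    let ?gx = "g (sup (a *\<^sub>R x) (b *\<^sub>R z))" and ?gy = "g (sup (a *\<^sub>R y) (b *\<^sub>R z))"
    have mem: "sup (a *\<^sub>R x) (b *\<^sub>R z) \<in> orthant" "sup (a *\<^sub>R y) (b *\<^sub>R z) \<in> orthant"
      using ab x y by (auto intro: sup_scaled_in_orthant)
    have "\<bar>?gx - ?gy\<bar> \<le> 1 * l1_norm (sup (a *\<^sub>R x) (b *\<^sub>R z) - sup (a *\<^sub>R y) (b *\<^sub>R z))"
      using g(1) mem unfolding lipschitz_l1_def by blast
    also have "\<dots> \<le> a * l1_norm (x - y)"
      using l1_norm_sup_scaled_diff[OF less_imp_le[OF ab(1)]] by simp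
    finally have diff: "a * \<bar>?gx - ?gy\<bar> \<le> a * (a * l1_norm (x - y))"
      using ab by (intro mult_left_mono) auto
    have one: "a * \<bar>?gy\<bar> \<le> a" using ab g(2)[OF mem(2)] by simp
    have "a * x $ j \<le> a * y $ j" using ab le by simp
    then consider "b * z $ j \<le> a * x $ j" "b * z $ j \<le> a * y $ j"
      | "a * x $ j < b * z $ j" "b * z $ j \<le> a * y $ j"
      | "a * x $ j < b * z $ j" "a * y $ j < b * z $ j" by linarith
    then show "norm (?f x z - ?f y z) \<le> ?B z"
    proof cases
      case 1
      then have "norm (?f x z - ?f y z) = a * \<bar>?gx - ?gy\<bar>"
        using ab by (simp add: abs_mult flip: right_diff_distrib)
      then show ?thesis using 1 z diff by simp
    next
      case 2
      then show ?thesis using z one ab by (simp add: abs_mult indicator_def)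
    next
      case 3
      then show ?thesis by (simp add: indicator_def)
    qed
  qed
  also have "\<dots> = a * (a * l1_norm (x - y)) * prob (?A x) + a * (prob (?A y) - prob (?A x))"
    using ind by (simp add: Bochner_Integration.integral_add Bochner_Integration.integral_diff)
  finally show ?thesis by (simp add: prob_no_exceedance[OF ab(2)])
qed

text \<open>The distance is split into the part \<open>\<delta>\<close> from coordinate
  \<open>j\<close> and the rest \<open>R\<close>. The increment of the distribution function
  involves only \<open>\<delta>\<close>, so the large factor \<open>\<alpha> * (a / b)\<close> is
  paid only there.\<close>

lemma smoothed_partial_lipschitz:
  assumes ab: "0 < a" "a \<le> 1" "0 < b" "b \<le> 1"
    and g: "lipschitz_l1 1 g" "\<And>x. x \<in> orthant \<Longrightarrow> \<bar>g x\<bar> \<le> 1"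
  shows "lipschitz_l1 ((real CARD('d) - 1) * a + \<alpha> * (a / b)) (smoothed_partial a b g j)"
proof -
  define c where "c = a / b"
  \<comment> \<open>\<open>a \<le> c\<close> follows from \<open>b \<le> 1\<close>.\<close>
  have c: "0 < c" "a \<le> c" using ab by (auto simp: c_def field_simps)
  have ordered: "\<bar>smoothed_partial a b g j x - smoothed_partial a b g j y\<bar>
      \<le> ((real CARD('d) - 1) * a + \<alpha> * c) * l1_norm (x - y)"
    if x: "x \<in> orthant" and y: "y \<in> orthant" and le: "x $ j \<le> y $ j" for x y
  proof -
    define \<delta> where "\<delta> = y $ j - x $ j"
    define R where "R = (\<Sum>i\<in>UNIV - {j}. \<bar>x $ i - y $ i\<bar>)"
    define p where "p = frechet_cdf \<alpha> (c * x $ j)"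
    have \<delta>: "0 \<le> \<delta>" using le by (simp add: \<delta>_def)
    have R: "0 \<le> R" by (simp add: R_def sum_nonneg)
    have p: "0 \<le> p" "p \<le> 1" by (simp_all add: p_def frechet_cdf_nonneg frechet_cdf_le_1)
    have norm: "l1_norm (x - y) = \<delta> + R"
      unfolding l1_norm_def R_def \<delta>_def using le by (subst sum.remove[of _ j]) auto
    \<comment> \<open>In dimension one both sides are 0, because the sum \<open>R\<close> is empty;
      otherwise the factor is at least 1.\<close>
    have d1: "R \<le> (real CARD('d) - 1) * R"
    proof (cases "UNIV - {j} = {}")
      case True
      then have "R = 0" unfolding R_def by (metis sum.empty)
      then show ?thesis by simp
    next
      case False
      then have "card (UNIV - {j}) \<noteq> 0" by (metis card_0_eq finite)
      then have "1 \<le> real CARD('d) - 1" by (subst (asm) card_Diff_singleton) auto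
      from mult_right_mono[OF this R] show ?thesis by simp
    qed
    have inc: "frechet_cdf \<alpha> (c * y $ j) - p \<le> \<alpha> * (c * \<delta>) - c * \<delta> * p"
      using frechet_cdf_increment[of \<alpha> "c * x $ j" "c * y $ j"] alpha_gt_1 c x le
      by (simp add: p_def \<delta>_def orthant_iff algebra_simps)
    have "\<bar>smoothed_partial a b g j x - smoothed_partial a b g j y\<bar>
        \<le> a * (a * (\<delta> + R)) * p + a * (frechet_cdf \<alpha> (c * y $ j) - p)"
      using smoothed_partial_diff[OF ab(1,3) g x y le] by (simp add: norm p_def c_def)
    also have "\<dots> \<le> a * (a * (\<delta> + R)) * p + a * (\<alpha> * (c * \<delta>) - c * \<delta> * p)"
      using inc ab by (intro add_left_mono mult_left_mono) auto
    \<comment> \<open>The Lipschitz contribution in coordinate \<open>j\<close> meets the negative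
      term of \<open>inc\<close>; as \<open>a \<le> c\<close>, the two together are at most
      0.\<close>
    also have "\<dots> = a * (a * p) * R + (a * \<delta> * p) * (a - c) + a * (\<alpha> * c * \<delta>)"
      by (simp add: algebra_simps)
    also have "\<dots> \<le> a * R + 0 + \<alpha> * c * \<delta>"
    proof (intro add_mono)
      have "a * p \<le> 1" using ab p by (simp add: mult_le_one)
      then show "a * (a * p) * R \<le> a * R"
        using ab R by (intro mult_right_mono) auto
      show "a * \<delta> * p * (a - c) \<le> 0"
        using ab \<delta> p c by (intro mult_nonneg_nonpos) auto
      show "a * (\<alpha> * c * \<delta>) \<le> \<alpha> * c * \<delta>"
        using ab alpha_gt_1 c \<delta> by (intro mult_left_le_one_le) auto
    qed
    also have "\<dots> \<le> (real CARD('d) - 1) * a * R + \<alpha> * c * \<delta>"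
      using mult_left_mono[OF d1, of a] ab by (simp add: algebra_simps)
    \<comment> \<open>The missing cross terms of the product are nonnegative.\<close>
    also have "\<dots> \<le> ((real CARD('d) - 1) * a + \<alpha> * c) * (\<delta> + R)"
    proof -
      have "1 \<le> real CARD('d)" by (simp add: Suc_leI)
      then have "0 \<le> (real CARD('d) - 1) * a * \<delta>" "0 \<le> \<alpha> * c * R"
        using ab c alpha_gt_1 \<delta> R by auto
      then show ?thesis by (simp add: algebra_simps)
    qed
    finally show ?thesis by (simp add: norm)
  qed
  have sym: "l1_norm (x - y) = l1_norm (y - x)" for x y :: "real ^ 'd"
    unfolding l1_norm_def by (simp add: abs_minus_commute)
  show ?thesis
    unfolding lipschitz_l1_def c_def[symmetric]
  proof (intro ballI)
    fix x y :: "real ^ 'd" assume x: "x \<in> orthant" and y: "y \<in> orthant"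
    show "\<bar>smoothed_partial a b g j x - smoothed_partial a b g j y\<bar>
        \<le> ((real CARD('d) - 1) * a + \<alpha> * c) * l1_norm (x - y)"
      using ordered[OF x y] ordered[OF y x] sym[of x y] by (metis abs_minus_commute linear)
  qed
qed

end

subsection \<open>The semi-group\<close>

lemma max_stable_law_frechet_margins:
  fixes N :: "real ^ 'd \<Rightarrow> real"
  assumes "\<alpha> > 1" "is_norm N" "angular_measure N \<nu>" "max_stable_law \<alpha> \<nu> D"
  shows "frechet_margins D \<alpha>"
proof -
  have "prob_space D" using assms(4) by (simp add: max_stable_law_def)
  moreover have "frechet_margins_axioms D \<alpha>"
    using assms max_stable_law_margin[OF _ assms(2-4)]
    by (simp add: frechet_margins_axioms_def max_stable_law_def)
  ultimately show ?thesis by (simp add: frechet_margins_def)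
qed

lemma measure_frechet_law:
  assumes "frechet_law \<alpha> F"
  shows "measure F {\<zeta>. \<zeta> \<le> s} = frechet_cdf \<alpha> s"
  using assms by (simp add: frechet_law_def frechet_cdf_def cdf_def atMost_def)

text \<open>The last identity comes from \<open>gamma_t t = exp t * (1 - exp (- t))\<close>; it
  links the ratio of the two scales to the argument in \<open>p_vec\<close>.\<close>

lemma semigroup_scales:
  fixes \<alpha> t :: real
  assumes "\<alpha> > 0" "t > 0"
  shows "0 < exp (- t / \<alpha>)" "exp (- t / \<alpha>) \<le> 1"
    and "0 < (1 - exp (- t)) powr (1 / \<alpha>)" "(1 - exp (- t)) powr (1 / \<alpha>) \<le> 1"
    and "exp (- t / \<alpha>) / (1 - exp (- t)) powr (1 / \<alpha>) = gamma_t t powr (- 1 / \<alpha>)"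
proof -
  have u: "0 < 1 - exp (- t)" "1 - exp (- t) \<le> 1" using assms by auto
  show "0 < exp (- t / \<alpha>)" "exp (- t / \<alpha>) \<le> 1" using assms by auto
  show "0 < (1 - exp (- t)) powr (1 / \<alpha>)" "(1 - exp (- t)) powr (1 / \<alpha>) \<le> 1"
    using u assms by (auto simp: powr_le1)
  have "gamma_t t = exp t * (1 - exp (- t))"
    by (simp add: gamma_t_def exp_minus field_simps)
  then have "gamma_t t powr (- 1 / \<alpha>) = exp t powr (- 1 / \<alpha>) * (1 - exp (- t)) powr (- 1 / \<alpha>)"
    using u by (simp add: powr_mult)
  also have "exp t powr (- 1 / \<alpha>) = exp (- t / \<alpha>)" by (simp add: powr_def)
  also have "(1 - exp (- t)) powr (- 1 / \<alpha>) = 1 / (1 - exp (- t)) powr (1 / \<alpha>)"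
    using powr_minus_divide[of "1 - exp (- t)" "1 / \<alpha>"] by simp
  finally show "exp (- t / \<alpha>) / (1 - exp (- t)) powr (1 / \<alpha>) = gamma_t t powr (- 1 / \<alpha>)"
    by simp
qed

text \<open>At time 0 the factor of \<open>z\<close> is \<open>0 powr (1 / \<alpha>) = 0\<close>, so
  the integrand is constant.\<close>

lemma semigroup_P_0:
  assumes "prob_space D" "x \<in> orthant"
  shows "semigroup_P \<alpha> D 0 h x = h x"
proof -
  have "sup x 0 = x" using assms(2) by (simp add: orthant_def sup_absorb1)
  then show ?thesis using prob_space.prob_space[OF assms(1)] by (simp add: semigroup_P_def)
qed

text \<open>Time 0 is separate because the smoothing lemmas require \<open>b > 0\<close>. The
  identity with \<open>h\<close> is available only on the orthant, hence the transfer of derivatives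
  within \<open>{0..}\<close>.\<close>

lemma semigroup_P_0_C1:
  assumes "prob_space D" "h \<in> C1_orthant"
  shows "semigroup_P \<alpha> D 0 h \<in> C1_orthant"
    and "x \<in> orthant \<Longrightarrow> partial_deriv j (semigroup_P \<alpha> D 0 h) x = partial_deriv j h x"
proof -
  have deriv: "(coord_section j (semigroup_P \<alpha> D 0 h) x has_real_derivative partial_deriv j h x)
      (at (x $ j) within {0..})" if x: "x \<in> orthant" for j x
  proof (rule has_field_derivative_transform_within[where d = 1])
    show "(coord_section j h x has_real_derivative partial_deriv j h x) (at (x $ j) within {0..})"
      using assms(2) x by (intro coord_section_has_partial_deriv) (simp_all add: C1_orthant_def)
    show "x $ j \<in> {0..}" using x by (simp add: orthant_iff)
    show "coord_section j h x s = coord_section j (semigroup_P \<alpha> D 0 h) x s" if "s \<in> {0..}" for s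
      using semigroup_P_0[OF assms(1) coord_section_in_orthant[OF x]] that
      by (simp add: coord_section_def)
  qed simp
  show "semigroup_P \<alpha> D 0 h \<in> C1_orthant"
    by (rule C1_orthantI[OF deriv]) (use assms(2) in \<open>auto simp: C1_orthant_def\<close>)
  show "x \<in> orthant \<Longrightarrow> partial_deriv j (semigroup_P \<alpha> D 0 h) x = partial_deriv j h x"
    by (rule partial_deriv_eqI[OF _ deriv])
qed

lemma lipschitz_l1_weaken:
  assumes "lipschitz_l1 C h" "C \<le> C'"
  shows "lipschitz_l1 C' h"
  unfolding lipschitz_l1_def
proof (intro ballI)
  fix x y :: "real ^ 'a" assume "x \<in> orthant" "y \<in> orthant"
  then have "\<bar>h x - h y\<bar> \<le> C * l1_norm (x - y)" using assms(1) by (simp add: lipschitz_l1_def)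
  also have "\<dots> \<le> C' * l1_norm (x - y)" by (rule mult_right_mono[OF assms(2) l1_norm_nonneg])
  finally show "\<bar>h x - h y\<bar> \<le> C' * l1_norm (x - y)" .
qed

theorem theorem5:
  fixes \<alpha> :: real
    and N :: "real ^ 'd \<Rightarrow> real"
    and \<nu> D :: "(real ^ 'd) measure"
    and F :: "real measure"
    and h :: "real ^ 'd \<Rightarrow> real"
  assumes "\<alpha> > 1"
    and "is_norm N"
    and "pos_sphere N \<subseteq> {0..1}"
    and "angular_measure N \<nu>"
    and "max_stable_law \<alpha> \<nu> D"
    and "frechet_law \<alpha> F"
    and "h \<in> C1_orthant \<inter> Lip1"
  shows "(\<forall>t\<ge>0. semigroup_P \<alpha> D t h \<in> C1_orthant \<inter> Lip1) \<and>
    (\<forall>j. \<forall>t\<ge>0. \<forall>x\<in>orthant.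
       \<bar>partial_deriv j (semigroup_P \<alpha> D t h) x\<bar> \<le> exp (- t / \<alpha>) * p_vec \<alpha> F t x $ j) \<and>
    (\<forall>t\<ge>0. \<forall>x\<in>orthant.
       l1_norm (gradient (semigroup_P \<alpha> D t h) x) \<le> exp (- t / \<alpha>) * l1_norm (p_vec \<alpha> F t x)) \<and>
    (\<forall>t\<ge>0. lipschitz_l1 (real CARD('d) * exp (- t / \<alpha>)) (semigroup_P \<alpha> D t h)) \<and>
    (h \<in> Lip1_2 \<longrightarrow>
       (\<forall>j. \<forall>t>0. lipschitz_l1
          ((real CARD('d) - 1) * exp (- t / \<alpha>) + \<alpha> * gamma_t t powr (- 1 / \<alpha>))
          (partial_deriv j (semigroup_P \<alpha> D t h))))"
proof -
  interpret frechet_margins D \<alpha>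
    using max_stable_law_frechet_margins assms by blast
  interpret F: real_distribution F using assms(6) by (simp add: frechet_law_def)
  define a where "a t = exp (- t / \<alpha>)" for t
  define b where "b t = (1 - exp (- t)) powr (1 / \<alpha>)" for t
  have \<alpha>0: "\<alpha> > 0" using assms(1) by simp
  note scales = semigroup_scales[OF \<alpha>0, folded a_def b_def]
  have P: "semigroup_P \<alpha> D t h = smoothed (a t) (b t) h" for t
    by (rule ext) (simp add: semigroup_P_def smoothed_def a_def b_def)
  have h: "h \<in> C1_orthant" "lipschitz_l1 1 h" using assms(7) by (auto simp: Lip1_def)
  have cont: "continuous_on orthant (partial_deriv j h)" for j using h by (simp add: C1_orthant_def)
  have g1: "\<bar>partial_deriv j h x\<bar> \<le> 1" if "x \<in> orthant" for j x
    using abs_partial_deriv_le[OF _ h(2) that] h(1) by (simp add: C1_orthant_def)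
  have a: "0 < a t" "a t \<le> 1" if "t \<ge> 0" for t using that \<alpha>0 by (auto simp: a_def)
  have p: "p_vec \<alpha> F t x $ j = frechet_cdf \<alpha> (a t / b t * x $ j)" if "t > 0" for t x j
    using that scales(5)[OF that] measure_frechet_law[OF assms(6)] by (simp add: p_vec_def)
  \<comment> \<open>The event reads \<open>0 * \<zeta> \<le> x $ j\<close> and is the whole
    line.\<close>
  have p0: "p_vec \<alpha> F 0 x $ j = 1" if "x \<in> orthant" for x j
    using that F.prob_space by (simp add: p_vec_def gamma_t_def orthant_iff)
  have C1: "semigroup_P \<alpha> D t h \<in> C1_orthant" if "t \<ge> 0" for t
  proof (cases "t = 0")
    case True
    then show ?thesis using semigroup_P_0_C1(1)[OF prob_space_axioms h(1)] by simp
  next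
    case False
    then show ?thesis
      using smoothed_in_C1(1)[OF scales(1,3) h] that by (simp add: P)
  qed
  \<comment> \<open>Only \<open>b t \<ge> 0\<close> is required, so time 0 is included without a
    case split.\<close>
  have lip: "lipschitz_l1 (a t) (semigroup_P \<alpha> D t h)" if "t \<ge> 0" for t
    unfolding P using smoothed_lipschitz[of "a t" "b t" h] a[OF that] h by (simp add: b_def)
  have bound: "\<bar>partial_deriv j (semigroup_P \<alpha> D t h) x\<bar> \<le> a t * p_vec \<alpha> F t x $ j"
    if "t \<ge> 0" "x \<in> orthant" for j t x
  proof (cases "t = 0")
    case True
    then show ?thesis
      using semigroup_P_0_C1(2)[OF prob_space_axioms h(1) that(2)] g1[OF that(2)] p0[OF that(2)]
      by (simp add: a_def)
  next
    case False
    then have t: "t > 0" using that by simp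
    show ?thesis
      unfolding P smoothed_in_C1(2)[OF scales(1,3)[OF t] h that(2)] p[OF t]
      by (rule smoothed_partial_bound[OF scales(1,3)[OF t] cont g1 that(2)])
  qed
  have "semigroup_P \<alpha> D t h \<in> C1_orthant \<inter> Lip1" if "t \<ge> 0" for t
    using C1[OF that] lipschitz_l1_weaken[OF lip a(2)] that by (simp add: Lip1_def)
  moreover have "l1_norm (gradient (semigroup_P \<alpha> D t h) x) \<le> a t * l1_norm (p_vec \<alpha> F t x)"
    if "t \<ge> 0" "x \<in> orthant" for t x
    unfolding l1_norm_def sum_distrib_left
  proof (rule sum_mono)
    fix j
    have "a t * p_vec \<alpha> F t x $ j \<le> a t * \<bar>p_vec \<alpha> F t x $ j\<bar>"
      using a[OF that(1)] by (intro mult_left_mono) auto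
    then show "\<bar>gradient (semigroup_P \<alpha> D t h) x $ j\<bar> \<le> a t * \<bar>p_vec \<alpha> F t x $ j\<bar>"
      using bound[OF that, of j] by (simp add: gradient_def)
  qed
  moreover have "lipschitz_l1 (real CARD('d) * a t) (semigroup_P \<alpha> D t h)" if "t \<ge> 0" for t
  proof (rule lipschitz_l1_weaken[OF lip[OF that]])
    have "1 \<le> real CARD('d)" by (simp add: Suc_leI)
    from mult_right_mono[OF this less_imp_le[OF a(1)[OF that]]]
    show "a t \<le> real CARD('d) * a t" by simp
  qed
  moreover have "lipschitz_l1 ((real CARD('d) - 1) * a t + \<alpha> * gamma_t t powr (- 1 / \<alpha>))
      (partial_deriv j (semigroup_P \<alpha> D t h))" if "h \<in> Lip1_2" "t > 0" for j t
  proof -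
    have g: "lipschitz_l1 1 (partial_deriv j h)" using that(1) by (simp add: Lip1_2_def)
    show ?thesis
      \<comment> \<open>\<open>lipschitz_l1\<close> is unfolded because the derivative agrees with
        \<open>smoothed_partial\<close> at points of the orthant, the only ones it tests.\<close>
      using smoothed_partial_lipschitz[OF scales(1-4)[OF that(2)] g g1, of j]
      unfolding lipschitz_l1_def P scales(5)[OF that(2)]
      by (simp add: smoothed_in_C1(2)[OF scales(1,3)[OF that(2)] h])
  qed
  ultimately show ?thesis
    using bound unfolding a_def by blast
qed

end
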